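(* Let $n\ge 1$, $V\in C^2(\mathbb{R}^n,\mathbb{R})$ and $h\in\mathbb{R}$. Suppose that: (1) $V(-q)=V(q)$ for all $q\in\mathbb{R}^n$; (2) $\mu_1>0$ and $\mu_2\ge 0$ are constants such that $V'(q)\cdot q\ge \mu_1 V(q)-\mu_2$ for all $q\in\mathbb{R}^n$; (3) $V(q)\ge h$ for all $q$ with $|q|$ sufficiently large; (4) $3V'(q)\cdot q+V''(q)q\cdot q\neq 0$ for all $q\in\mathbb{R}^n\setminus\{0\}$. If $h>\mu_2/\mu_1$, then there is at least one non-constant periodic solution $q:\mathbb{R}\to\mathbb{R}^n$ of the system $$\ddot q+V'(q)=0,\qquad \tfrac12|\dot q|^2+V(q)=h.$$
   Context: $V'$ denotes the gradient and $V''$ the Hessian of $V$; $\cdot$ is the Euclidean inner product on $\mathbb{R}^n$. *)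

theory Defs
  imports "HOL-Analysis.Analysis"
begin

text \<open>
  The gradient and the Hessian matrix; both are meaningful only at points where the
  respective derivative exists, as guaranteed by \<open>C2_function\<close> below.
\<close>

definition gradient :: "(real^'n \<Rightarrow> real) \<Rightarrow> real^'n \<Rightarrow> real^'n" where
  "gradient V q = (THE D. GDERIV V q :> D)"

definition hessian :: "(real^'n \<Rightarrow> real) \<Rightarrow> real^'n \<Rightarrow> real^'n^'n" where
  "hessian V q = matrix (frechet_derivative (gradient V) (at q))"

text \<open>Continuity of \<open>V\<close> and of its gradient is implied by differentiability.\<close>

definition C2_function :: "(real^'n \<Rightarrow> real) \<Rightarrow> bool" where
  "C2_function V \<longleftrightarrow>
     (\<forall>q. V differentiable (at q)) \<and>
     (\<forall>q. gradient V differentiable (at q)) \<and>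
     continuous_on UNIV (hessian V)"

text \<open>
  Classical solutions, defined for all times, of the system
  \<open>q'' + V'(q) = 0\<close>, \<open>|q'|^2 / 2 + V(q) = h\<close>. The function \<open>v\<close> is the velocity \<open>q'\<close>
  and \<open>a\<close> the acceleration \<open>q''\<close>.
\<close>

definition solves_fixed_energy_system ::
    "(real^'n \<Rightarrow> real) \<Rightarrow> real \<Rightarrow> (real \<Rightarrow> real^'n) \<Rightarrow> bool" where
  "solves_fixed_energy_system V h q \<longleftrightarrow>
     (\<exists>v a. (\<forall>t. (q has_vector_derivative v t) (at t)) \<and>
            (\<forall>t. (v has_vector_derivative a t) (at t)) \<and>
            (\<forall>t. a t + gradient V (q t) = 0) \<and>
            (\<forall>t. (norm (v t))\<^sup>2 / 2 + V (q t) = h))"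

end

theory Submission
  imports Defs "HOL-Complex_Analysis.Great_Picard"
begin

text \<open>
The solution is a rescaled minimiser of the Maupertuis functional on loops that are antiperiodic in
time, \<open>u (t + 1) = - u t\<close>. For such a loop put
\<open>f(u) = (1/2) \<integral>|u'|\<^sup>2 \<cdot> \<integral>(h - V(u))\<close>, integrated over a half period. A critical point of \<open>f\<close> with
positive value satisfies \<open>u'' = - \<omega> V'(u)\<close> for the positive number
\<open>\<omega> = (1/2) \<integral>|u'|\<^sup>2 / \<integral>(h - V(u))\<close>. The choice of \<open>\<omega>\<close> says that the conserved quantity
\<open>|u'|\<^sup>2/2 + \<omega> V(u)\<close> has mean \<open>\<omega> h\<close>, so it equals \<open>\<omega> h\<close>, and \<open>q t = u (t / sqrt \<omega>)\<close> is a solution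
of energy \<open>h\<close>. Antiperiodicity excludes every constant loop but \<open>0\<close>, and \<open>0\<close> is excluded by its energy.

Minimisation takes place under the constraint \<open>\<integral>G(u) = h\<close> with \<open>G(q) = V(q) + V'(q) \<bullet> q / 2\<close>, which
says that the derivative of \<open>s \<mapsto> f(s u)\<close> vanishes at \<open>s = 1\<close>. The nondegeneracy hypothesis on \<open>3 V'(q) \<bullet> q + V''(q) q \<bullet> q\<close>
makes \<open>G\<close> strictly increasing on every ray from the origin (\<open>G_strict_on_rays\<close>): this quantity
is \<open>2 s\<close> times the derivative of \<open>G\<close> along the ray, and \<open>G\<close> starts below \<open>h\<close> and ends above it. Hence
a ray of loops that meets the constraint does so once, at the maximum of \<open>f\<close> on the ray, so that a
minimiser under the constraint is a critical point of \<open>f\<close> itself (\<open>minimizer_critical\<close>). The growth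
hypothesis bounds the mean of \<open>h - V(u)\<close> from below on the constraint (\<open>pot_lower\<close>), so \<open>f\<close> controls \<open>\<integral>|u'|\<^sup>2\<close>,
and antiperiodicity turns this into a bound on \<open>sup |u|\<close>.

The problem is solved in discrete time, where a loop is a sequence \<open>u :: int \<Rightarrow> 'a\<close> with
\<open>u (k + N) = - u k\<close>. The minimisation is then finite dimensional, and all bounds are uniform in \<open>N\<close>
(\<open>discrete_solutions_exist\<close>). The discrete equation makes the sequences and their difference
quotients Lipschitz on the scale \<open>1/N\<close>; a diagonal subsequence converges at all times, and a
second-order estimate that survives the limit gives the derivatives (\<open>has_vector_derivative_of_discrete_limit\<close>).
\<close>

section \<open>From difference quotients to derivatives\<close>

lemma norm_diff_le_steps:
  fixes a :: "int \<Rightarrow> 'a::real_normed_vector"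
  assumes "\<And>k. norm (a (k + 1) - a k) \<le> L"
  shows "norm (a j - a i) \<le> L * \<bar>real_of_int (j - i)\<bar>"
proof -
  have up: "norm (a (i + int m) - a i) \<le> L * m" for i m
  proof (induction m)
    case (Suc m)
    have "norm (a (i + int (Suc m)) - a i)
        \<le> norm (a (i + int m + 1) - a (i + int m)) + norm (a (i + int m) - a i)"
      by (rule order_trans[OF _ norm_triangle_ineq]) (simp add: add.commute add.left_commute)
    then show ?case
      using Suc assms[of "i + int m"] by (simp add: algebra_simps)
  qed simp
  show ?thesis
  proof (cases "i \<le> j")
    case True
    then show ?thesis using up[of i "nat (j - i)"] by simp
  next
    case False
    then show ?thesis using up[of j "nat (i - j)"] by (simp add: norm_minus_commute)
  qed
qed

text \<open>
The discrete analogue of \<open>|a(t) - a(s) - (t - s) a'(s)| \<le> C (t - s)\<^sup>2\<close> for a Lipschitz derivative,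
where \<open>b\<close> is the difference quotient of \<open>a\<close> with step \<open>1 / N\<close>. The inequality mentions
\<open>a\<close> and \<open>b\<close> only at single points, so pointwise convergence preserves it.
\<close>

lemma discrete_taylor:
  fixes a b :: "int \<Rightarrow> 'a::real_normed_vector"
  assumes N: "N > 0"
    and step: "\<And>k. a (k + 1) - a k = (1 / N) *\<^sub>R b k"
    and lip: "\<And>k. norm (b (k + 1) - b k) \<le> L / N"
  shows "norm (a j - a i - (real_of_int (j - i) / N) *\<^sub>R b i) \<le> 2 * L * (real_of_int (j - i) / N)\<^sup>2"
proof -
  have "0 \<le> L / N" using lip[of 0] norm_ge_zero order_trans by blast
  then have L: "L \<ge> 0" using N by (simp add: zero_le_divide_iff)
  \<comment> \<open>Forwards the constant is L, by m^2 + m <= (m + 1)^2; going backwards, replacing the slope at the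
    left end by the slope at the right end costs another L.\<close>
  have up: "norm (a (i + int m) - a i - (m / N) *\<^sub>R b i) \<le> L * (m / N)\<^sup>2" for i m
  proof (induction m)
    case (Suc m)
    have eq: "a (i + int (Suc m)) - a i - (Suc m / N) *\<^sub>R b i
        = (a (i + int m) - a i - (m / N) *\<^sub>R b i) + (1 / N) *\<^sub>R (b (i + int m) - b i)"
      using step[of "i + int m"] by (simp add: algebra_simps add_divide_distrib)
    have "norm ((1 / N) *\<^sub>R (b (i + int m) - b i)) \<le> (1 / N) * (L / N * m)"
      using norm_diff_le_steps[of b "L / N" "i + int m" i, OF lip] N
        mult_left_mono[of "norm (b (i + int m) - b i)" "L / N * m" "1 / N"] by simp
    then have "norm (a (i + int (Suc m)) - a i - (Suc m / N) *\<^sub>R b i)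
        \<le> L * (m / N)\<^sup>2 + (1 / N) * (L / N * m)"
      unfolding eq using Suc norm_triangle_mono by blast
    also have "\<dots> = L * (real m ^ 2 + m) / N\<^sup>2"
      using N by (simp add: field_simps power2_eq_square)
    also have "\<dots> \<le> L * (real (Suc m))\<^sup>2 / N\<^sup>2"
      using L by (intro divide_right_mono mult_left_mono) (auto simp: power2_eq_square algebra_simps)
    finally show ?case by (simp add: power_divide)
  qed simp
  show ?thesis
  proof (cases "i \<le> j")
    case True
    have "norm (a j - a i - (real_of_int (j - i) / N) *\<^sub>R b i) \<le> L * (real_of_int (j - i) / N)\<^sup>2"
      using up[of i "nat (j - i)"] True by simp
    also have "\<dots> \<le> 2 * L * (real_of_int (j - i) / N)\<^sup>2"
      using L by (intro mult_right_mono) auto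
    finally show ?thesis .
  next
    case False
    define r where "r = real_of_int (i - j) / N"
    have r: "r \<ge> 0" using False N by (simp add: r_def)
    have eq: "a j - a i - (real_of_int (j - i) / N) *\<^sub>R b i
        = - (a i - a j - r *\<^sub>R b j) + r *\<^sub>R (b i - b j)"
      by (simp add: r_def algebra_simps diff_divide_distrib)
    have 1: "norm (a i - a j - r *\<^sub>R b j) \<le> L * r\<^sup>2"
      using up[of j "nat (i - j)"] False by (simp add: r_def)
    have "norm (b i - b j) \<le> L * r"
      using norm_diff_le_steps[of b "L / N" i j, OF lip] False by (simp add: r_def)
    then have 2: "norm (r *\<^sub>R (b i - b j)) \<le> L * r\<^sup>2"
      using r mult_left_mono[of "norm (b i - b j)" "L * r" r]
      by (simp add: power2_eq_square mult.left_commute)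
    have "norm (a j - a i - (real_of_int (j - i) / N) *\<^sub>R b i) \<le> L * r\<^sup>2 + L * r\<^sup>2"
      unfolding eq by (rule norm_triangle_mono) (use 1 2 in \<open>simp_all add: norm_minus_commute\<close>)
    also have "\<dots> = 2 * L * (real_of_int (j - i) / N)\<^sup>2"
      by (simp add: r_def power2_eq_square algebra_simps diff_divide_distrib)
    finally show ?thesis .
  qed
qed

lemma tendsto_floor_mult_div:
  assumes "filterlim N at_top sequentially"
  shows "(\<lambda>n. real_of_int \<lfloor>N n * t\<rfloor> / N n) \<longlonglongrightarrow> t"
proof -
  have "(\<lambda>n. 1 / N n) \<longlonglongrightarrow> 0"
    using tendsto_divide_0[OF tendsto_const filterlim_at_top_imp_at_infinity[OF assms]] by simp
  moreover have "\<forall>\<^sub>F n in sequentially. norm (real_of_int \<lfloor>N n * t\<rfloor> / N n - t) \<le> 1 / N n"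
    using filterlim_at_top_dense[THEN iffD1, rule_format, OF assms, of 0]
  proof eventually_elim
    case (elim n)
    have "real_of_int \<lfloor>N n * t\<rfloor> / N n - t = (real_of_int \<lfloor>N n * t\<rfloor> - N n * t) / N n"
      using elim by (simp add: field_simps)
    moreover have "\<bar>real_of_int \<lfloor>N n * t\<rfloor> - N n * t\<bar> \<le> 1" by linarith
    ultimately show ?case using elim by (simp add: divide_right_mono)
  qed
  ultimately have "(\<lambda>n. real_of_int \<lfloor>N n * t\<rfloor> / N n - t) \<longlonglongrightarrow> 0"
    by (rule Lim_null_comparison[rotated])
  then show ?thesis by (simp add: LIM_zero_iff)
qed

text \<open>
Sampling at \<open>\<lfloor>N t\<rfloor>\<close>, the discrete Taylor estimate passes to the limit and becomes
\<open>|A s - A t - (s - t) B t| \<le> C (s - t)\<^sup>2\<close>, which says that \<open>B t\<close> is the derivative.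
\<close>

lemma has_vector_derivative_of_discrete_limit:
  fixes a b :: "nat \<Rightarrow> int \<Rightarrow> 'a::real_normed_vector"
  assumes N: "filterlim N at_top sequentially"
    and taylor: "\<And>n i j. norm (a n j - a n i - (real_of_int (j - i) / N n) *\<^sub>R b n i)
                      \<le> C * (real_of_int (j - i) / N n)\<^sup>2"
    and A: "\<And>t. (\<lambda>n. a n \<lfloor>N n * t\<rfloor>) \<longlonglongrightarrow> A t"
    and B: "\<And>t. (\<lambda>n. b n \<lfloor>N n * t\<rfloor>) \<longlonglongrightarrow> B t"
  shows "(A has_vector_derivative B t) (at t)"
proof -
  have bound: "norm (A s - A t - (s - t) *\<^sub>R B t) \<le> C * (s - t)\<^sup>2" for s
  proof (rule LIMSEQ_le)
    let ?i = "\<lambda>n. \<lfloor>N n * t\<rfloor>" and ?j = "\<lambda>n. \<lfloor>N n * s\<rfloor>"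
    have "(\<lambda>n. real_of_int (?j n) / N n - real_of_int (?i n) / N n) \<longlonglongrightarrow> s - t"
      by (intro tendsto_intros tendsto_floor_mult_div N)
    then have r: "(\<lambda>n. real_of_int (?j n - ?i n) / N n) \<longlonglongrightarrow> s - t"
      by (simp add: diff_divide_distrib)
    show "(\<lambda>n. norm (a n (?j n) - a n (?i n) - (real_of_int (?j n - ?i n) / N n) *\<^sub>R b n (?i n)))
        \<longlonglongrightarrow> norm (A s - A t - (s - t) *\<^sub>R B t)"
      by (intro tendsto_intros A B r)
    show "(\<lambda>n. C * (real_of_int (?j n - ?i n) / N n)\<^sup>2) \<longlonglongrightarrow> C * (s - t)\<^sup>2"
      by (intro tendsto_intros r)
  qed (use taylor in blast)
  show ?thesis unfolding has_vector_derivative_def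
  proof (rule has_derivativeI_sandwich[of 1 _ _ _ _ "\<lambda>s. C * \<bar>s - t\<bar>"])
    show "((\<lambda>s. C * \<bar>s - t\<bar>) \<longlongrightarrow> 0) (at t)"
      by (rule tendsto_eq_intros refl)+ simp
    fix s assume "s \<noteq> t"
    then show "norm (A s - A t - (s - t) *\<^sub>R B t) / norm (s - t) \<le> C * \<bar>s - t\<bar>"
      using bound[of s] by (simp add: divide_le_eq power2_eq_square abs_mult_self_eq mult.assoc)
  qed (auto intro: bounded_linear_intros)
qed

text \<open>
A variant of the Arzela--Ascoli theorem for step functions: these are discontinuous, but
their modulus of continuity is Lipschitz up to an error that tends to zero. That is enough to carry
convergence from the rationals to all reals.
\<close>

lemma convergent_subsequence_almost_equicontinuous:
  fixes f :: "nat \<Rightarrow> real \<Rightarrow> 'b::{heine_borel,banach}"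
  assumes M: "\<And>n t. norm (f n t) \<le> M"
    and lip: "\<And>n s t. norm (f n s - f n t) \<le> L * \<bar>s - t\<bar> + d n"
    and d: "d \<longlonglongrightarrow> 0"
  obtains r g where "strict_mono (r :: nat \<Rightarrow> nat)" "\<And>t. (\<lambda>n. f (r n) t) \<longlonglongrightarrow> g t"
proof -
  obtain r where r: "strict_mono (r::nat\<Rightarrow>nat)"
    and conv: "\<And>t. t \<in> \<rat> \<Longrightarrow> \<exists>l. (\<lambda>n. f (r n) t) \<longlonglongrightarrow> l"
    using function_convergent_subsequence[OF countable_rat, of f M] M by blast
  have dr: "(\<lambda>n. d (r n)) \<longlonglongrightarrow> 0"
    using LIMSEQ_subseq_LIMSEQ[OF d r] by (simp add: o_def)
  have L: "L \<ge> 0"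
  proof -
    have "(\<lambda>n. L * \<bar>1 - 0\<bar> + d n) \<longlonglongrightarrow> L * \<bar>1 - 0\<bar> + 0"
      by (intro tendsto_intros d)
    moreover have "0 \<le> L * \<bar>1 - 0\<bar> + d n" for n
      using lip[of n 1 0] norm_ge_zero order_trans by blast
    ultimately show ?thesis using LIMSEQ_le_const[of _ "L * \<bar>1 - 0\<bar> + 0" 0] by force
  qed
  have "Cauchy (\<lambda>n. f (r n) t)" for t
  proof (rule CauchyI)
    fix e :: real assume e: "e > 0"
    obtain q where q: "q \<in> \<rat>" "t < q" "q < t + e / (6 * (L + 1))"
      using Rats_dense_in_real[of t "t + e / (6 * (L + 1))"] e L by auto
    have "L * \<bar>t - q\<bar> \<le> (L + 1) * (e / (6 * (L + 1)))"
      using q L by (intro mult_mono) auto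
    also have "\<dots> = e / 6" using L nonzero_mult_div_cancel_left[of "L + 1" "e / 6"] by (simp add: mult.commute)
    finally have tq: "L * \<bar>t - q\<bar> \<le> e / 6" .
    have "Cauchy (\<lambda>n. f (r n) q)" using conv[OF q(1)] convergent_eq_Cauchy by blast
    then obtain m1 where m1: "\<And>m n. m \<ge> m1 \<Longrightarrow> n \<ge> m1 \<Longrightarrow> norm (f (r m) q - f (r n) q) < e / 3"
      using e by (meson CauchyD divide_pos_pos zero_less_numeral)
    obtain m2 where m2: "\<And>n. n \<ge> m2 \<Longrightarrow> d (r n) < e / 6"
      using order_tendstoD(2)[OF dr, of "e / 6"] e by (auto simp: eventually_sequentially)
    have "norm (f (r m) t - f (r n) t) < e" if "m \<ge> max m1 m2" "n \<ge> max m1 m2" for m n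
    proof -
      have "norm (f (r m) t - f (r m) q) < e / 3" "norm (f (r n) t - f (r n) q) < e / 3"
        using lip[of "r m" t q] lip[of "r n" t q] tq m2[of m] m2[of n] that by auto
      moreover have "norm (f (r m) q - f (r n) q) < e / 3" using m1 that by auto
      ultimately have "norm ((f (r m) t - f (r m) q) + (f (r m) q - f (r n) q)
          - (f (r n) t - f (r n) q)) < e"
        using norm_triangle_ineq4[of "(f (r m) t - f (r m) q) + (f (r m) q - f (r n) q)" "f (r n) t - f (r n) q"]
          norm_triangle_ineq[of "f (r m) t - f (r m) q" "f (r m) q - f (r n) q"] by linarith
      then show ?thesis by (simp add: algebra_simps)
    qed
    then show "\<exists>M. \<forall>m\<ge>M. \<forall>n\<ge>M. norm (f (r m) t - f (r n) t) < e" by blast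
  qed
  then have "\<exists>l. (\<lambda>n. f (r n) t) \<longlonglongrightarrow> l" for t
    using convergent_eq_Cauchy by blast
  then obtain g where "\<And>t. (\<lambda>n. f (r n) t) \<longlonglongrightarrow> g t" by metis
  with r that show thesis by blast
qed

section \<open>Antiperiodic sequences\<close>

definition antiperiodic :: "nat \<Rightarrow> (int \<Rightarrow> 'a::ab_group_add) \<Rightarrow> bool" where
  "antiperiodic N u \<longleftrightarrow> (\<forall>k. u (k + int N) = - u k)"

lemma antiperiodicD: "antiperiodic N u \<Longrightarrow> u (k + int N) = - u k"
  by (simp add: antiperiodic_def)

text \<open>
The difference of the sums from \<open>k + 1\<close> and from \<open>k\<close> telescopes to \<open>f (k + N) - f k\<close>, so the sum
over a period is a function of \<open>k\<close> with step zero.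
\<close>

lemma sum_period_shift:
  fixes f :: "int \<Rightarrow> 'a::real_normed_vector"
  assumes per: "\<And>k. f (k + int N) = f k"
  shows "(\<Sum>j<N. f (k + int j)) = (\<Sum>j<N. f (int j))"
proof -
  have step: "(\<Sum>j<N. f (k + 1 + int j)) - (\<Sum>j<N. f (k + int j)) = 0" for k
  proof -
    have "(\<Sum>j<N. f (k + 1 + int j)) - (\<Sum>j<N. f (k + int j))
        = (\<Sum>j<N. f (k + int (Suc j)) - f (k + int j))"
      by (simp add: sum_subtractf algebra_simps)
    also have "\<dots> = 0"
      unfolding sum_lessThan_telescope[of "\<lambda>j. f (k + int j)"] using per[of k] by simp
    finally show ?thesis .
  qed
  then show ?thesis
    using norm_diff_le_steps[of "\<lambda>k. \<Sum>j<N. f (k + int j)" 0 k 0] by simp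
qed

text \<open>
The discrete Poincare inequality: \<open>u (k + N) - u k = - 2 u k\<close>, and the left-hand side is a sum of
increments. It is used for the loops and again for their velocities.
\<close>

lemma antiperiodic_norm_le:
  fixes u :: "int \<Rightarrow> 'a::real_normed_vector"
  assumes u: "antiperiodic N u"
  shows "2 * norm (u k) \<le> (\<Sum>j<N. norm (u (int j + 1) - u (int j)))"
proof -
  let ?d = "\<lambda>j. norm (u (j + 1) - u j)"
  have per: "?d (k + int N) = ?d k" for k
    using antiperiodicD[OF u, of k] antiperiodicD[OF u, of "k + 1"]
    by (simp add: algebra_simps norm_minus_commute)
  have "2 * norm (u k) = norm (u (k + int N) - u k)"
    using antiperiodicD[OF u, of k] norm_scaleR[of "- 2" "u k"]
    by (simp add: scaleR_2)
  also have "u (k + int N) - u k = (\<Sum>j<N. u (k + int j + 1) - u (k + int j))"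
    using sum_lessThan_telescope[of "\<lambda>j. u (k + int j)" N] by (simp add: algebra_simps)
  also have "norm \<dots> \<le> (\<Sum>j<N. ?d (k + int j))" by (rule norm_sum)
  also have "\<dots> = (\<Sum>j<N. ?d (int j))" by (rule sum_period_shift[of ?d]) (rule per)
  finally show ?thesis .
qed

lemma antiperiodic_norm_sq_le:
  fixes u :: "int \<Rightarrow> 'a::real_normed_vector"
  assumes u: "antiperiodic N u"
  shows "4 * (norm (u k))\<^sup>2 \<le> N * (\<Sum>j<N. (norm (u (int j + 1) - u (int j)))\<^sup>2)"
proof -
  have "4 * (norm (u k))\<^sup>2 = (2 * norm (u k))\<^sup>2" by (simp add: power_mult_distrib)
  also have "\<dots> \<le> (\<Sum>j<N. norm (u (int j + 1) - u (int j)))\<^sup>2"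
    by (intro power_mono antiperiodic_norm_le u) simp
  also have "\<dots> \<le> (\<Sum>j<N. (norm (u (int j + 1) - u (int j)))\<^sup>2) * N"
    using sum_squared_le_sum_of_squares[of "\<lambda>j. norm (u (int j + 1) - u (int j))" "{..<N}"] by simp
  finally show ?thesis by (simp add: mult.commute)
qed

text \<open>
There is no boundary term since \<open>(u k - u (k - 1)) \<bullet> w k\<close> is periodic.
\<close>

lemma antiperiodic_summation_by_parts:
  fixes u w :: "int \<Rightarrow> 'a::real_inner"
  assumes u: "antiperiodic N u" and w: "antiperiodic N w"
  shows "(\<Sum>j<N. (u (int j + 1) - u (int j)) \<bullet> (w (int j + 1) - w (int j)))
       = - (\<Sum>j<N. (u (int j + 1) - 2 *\<^sub>R u (int j) + u (int j - 1)) \<bullet> w (int j))"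
proof -
  let ?f = "\<lambda>k. (u k - u (k - 1)) \<bullet> w k"
  have per: "?f (k + int N) = ?f k" for k
    using antiperiodicD[OF u, of k] antiperiodicD[OF u, of "k - 1"] antiperiodicD[OF w, of k]
    by (simp add: algebra_simps inner_diff_left)
  have "(\<Sum>j<N. ?f (1 + int j)) = (\<Sum>j<N. ?f (int j))"
    by (rule sum_period_shift[of ?f]) (rule per)
  moreover have "(u (int j + 1) - u (int j)) \<bullet> (w (int j + 1) - w (int j))
      = ?f (1 + int j) - ?f (int j)
        - (u (int j + 1) - 2 *\<^sub>R u (int j) + u (int j - 1)) \<bullet> w (int j)" for j
    by (simp add: inner_diff_left inner_diff_right inner_add_left add.commute scaleR_2)
  ultimately show ?thesis by (simp add: sum_subtractf)
qed

lemma antiperiodic_extension: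
  fixes f :: "nat \<Rightarrow> 'a::ab_group_add"
  assumes N: "N > 0"
  obtains u where "antiperiodic N u" "\<And>k. k < N \<Longrightarrow> u (int k) = f k"
proof
  define u where "u k = (if even (k div int N) then f (nat (k mod int N)) else - f (nat (k mod int N)))" for k
  show "antiperiodic N u" using N by (auto simp: antiperiodic_def u_def)
  show "u (int k) = f k" if "k < N" for k using that by (simp add: u_def)
qed

section \<open>The natural constraint\<close>

text \<open>
Here \<open>\<psi> s e\<close> and \<open>\<gamma> s e\<close> are to be the functional and the constraint at the point \<open>s (u + e c)\<close>,
where \<open>u\<close> is the minimiser. If the derivative in direction \<open>c\<close> were negative at \<open>u\<close>, it would be negative
at all nearby points, so that \<open>\<psi> s e < \<psi> s 0 \<le> \<psi> 1 0\<close> for \<open>s\<close> near \<open>1\<close> and small \<open>e > 0\<close>. For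
small \<open>e\<close> the constraint still changes sign as \<open>s\<close> passes \<open>1\<close>, so one of these points is admissible, against
minimality.
\<close>

lemma constrained_minimum_derivative_nonneg:
  fixes \<psi> \<psi>' \<gamma> :: "real \<Rightarrow> real \<Rightarrow> real"
  assumes contS: "\<And>e. continuous_on UNIV (\<lambda>s. \<gamma> s e)"
    and contE: "\<And>s. continuous_on UNIV (\<gamma> s)"
    and neg: "\<And>s. 0 < s \<Longrightarrow> s < 1 \<Longrightarrow> \<gamma> s 0 < 0"
    and pos: "\<And>s. 1 < s \<Longrightarrow> \<gamma> s 0 > 0"
    and ray_max: "\<And>s. 0 < s \<Longrightarrow> \<psi> s 0 \<le> \<psi> 1 0"
    and der: "\<And>s e. (\<psi> s has_real_derivative \<psi>' s e) (at e)"
    and cont: "continuous_on UNIV (\<lambda>(s, e). \<psi>' s e)"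
    and minimal: "\<And>s e. 0 < s \<Longrightarrow> \<gamma> s e = 0 \<Longrightarrow> \<psi> 1 0 \<le> \<psi> s e"
  shows "0 \<le> \<psi>' 1 0"
proof (rule ccontr)
  assume "\<not> 0 \<le> \<psi>' 1 0"
  moreover have "open ((\<lambda>(s, e). \<psi>' s e) -` {..<0})"
    using cont by (simp add: open_vimage)
  ultimately obtain A B where AB: "open A" "open B" "(1, 0) \<in> A \<times> B"
    "A \<times> B \<subseteq> (\<lambda>(s, e). \<psi>' s e) -` {..<0}"
    by (rule_tac open_prod_elim[of _ "(1::real, 0::real)"]) auto
  obtain r1 where r1: "r1 > 0" "ball 1 r1 \<subseteq> A" using AB by (auto elim: openE)
  obtain r2 where r2: "r2 > 0" "ball 0 r2 \<subseteq> B" using AB by (auto elim: openE)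
  define d where "d = min (1 / 2) (r1 / 2)"
  have d: "0 < d" "d < 1" "d < r1" using r1 by (auto simp: d_def)
  have lim: "((\<gamma> s) \<longlongrightarrow> \<gamma> s 0) (at_right 0)" for s
    using contE[of s] by (simp add: continuous_on_eq_continuous_within isCont_def
        filterlim_at_split)
  have "\<forall>\<^sub>F e in at_right 0. \<gamma> (1 - d) e < 0"
    using order_tendstoD(2)[OF lim, of "1 - d" 0] neg[of "1 - d"] d by simp
  moreover have "\<forall>\<^sub>F e in at_right 0. \<gamma> (1 + d) e > 0"
    using order_tendstoD(1)[OF lim, of 0 "1 + d"] pos[of "1 + d"] d by simp
  moreover have "\<forall>\<^sub>F e in at_right (0::real). e < r2"
    using r2 by (auto simp: eventually_at_right_field)
  moreover have "\<forall>\<^sub>F e in at_right (0::real). 0 < e"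
    by (simp add: eventually_at_right_less)
  ultimately have "\<forall>\<^sub>F e in at_right 0. \<gamma> (1 - d) e < 0 \<and> \<gamma> (1 + d) e > 0 \<and> e < r2 \<and> 0 < e"
    by eventually_elim auto
  then obtain e where e: "\<gamma> (1 - d) e < 0" "\<gamma> (1 + d) e > 0" "e < r2" "0 < e"
    using eventually_happens[of _ "at_right (0::real)"] by auto
  have "\<exists>s\<ge>1 - d. s \<le> 1 + d \<and> \<gamma> s e = 0"
    using e d contS[of e] by (intro IVT') (auto intro: continuous_on_subset)
  then obtain s where s: "1 - d \<le> s" "s \<le> 1 + d" "\<gamma> s e = 0" by blast
  have "\<psi> s e < \<psi> s 0"
  proof (rule DERIV_neg_imp_decreasing[OF e(4)])
    fix x assume x: "0 \<le> x" "x \<le> e"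
    have "s \<in> A" using s d r1(2) by (intro subsetD[OF r1(2)]) (auto simp: dist_real_def)
    moreover have "x \<in> B" using x e r2(2) by (intro subsetD[OF r2(2)]) (auto simp: dist_real_def)
    ultimately have "\<psi>' s x < 0" using AB(4) by auto
    then show "\<exists>y. (\<psi> s has_real_derivative y) (at x) \<and> y < 0" using der by blast
  qed
  moreover have "\<psi> s 0 \<le> \<psi> 1 0" "\<psi> 1 0 \<le> \<psi> s e" using ray_max minimal s d by auto
  ultimately show False by simp
qed

section \<open>Even potential wells\<close>

text \<open>
The derivatives are explicit functions here, so that the argument applies to every Euclidean space. Continuity of the
second derivative enters through the Lipschitz bound for \<open>V'\<close> on balls. Multiplying \<open>h > \<mu>\<^sub>2 / \<mu>\<^sub>1\<close> by \<open>\<mu>\<^sub>1\<close> gives \<open>level\<close>.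
\<close>

locale even_potential_well =
  fixes V :: "'a::euclidean_space \<Rightarrow> real" and V' :: "'a \<Rightarrow> 'a" and V'' :: "'a \<Rightarrow> 'a \<Rightarrow> 'a"
    and h \<mu>\<^sub>1 \<mu>\<^sub>2 R :: real
  assumes gradient: "\<And>q. GDERIV V q :> V' q"
    and hessian: "\<And>q. (V' has_derivative V'' q) (at q)"
    and locally_lipschitz: "\<And>C. \<exists>K. K-lipschitz_on (cball 0 C) V'"
    and even: "\<And>q. V (- q) = V q"
    and \<mu>\<^sub>1_pos: "\<mu>\<^sub>1 > 0"
    and growth: "\<And>q. \<mu>\<^sub>1 * V q - \<mu>\<^sub>2 \<le> V' q \<bullet> q"
    and far: "\<And>q. R \<le> norm q \<Longrightarrow> h \<le> V q"
    and nondegenerate: "\<And>q. q \<noteq> 0 \<Longrightarrow> 3 * (V' q \<bullet> q) + V'' q q \<bullet> q \<noteq> 0"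
    and level: "\<mu>\<^sub>2 < \<mu>\<^sub>1 * h"
begin

lemma V_has_derivative: "(V has_derivative (\<lambda>v. V' q \<bullet> v)) (at q)"
  using gradient[of q] by (simp add: gderiv_def inner_commute)

lemma continuous_V: "continuous_on A V"
  by (intro continuous_at_imp_continuous_on ballI has_derivative_continuous[OF V_has_derivative])

lemma continuous_V': "continuous_on A V'"
  by (intro continuous_at_imp_continuous_on ballI has_derivative_continuous[OF hessian])

lemma DERIV_V_along:
  assumes "(f has_vector_derivative f') (at t)"
  shows "((\<lambda>t. V (f t)) has_real_derivative V' (f t) \<bullet> f') (at t)"
  unfolding has_field_derivative_def
  by (rule has_derivative_eq_rhs[OF has_derivative_compose[OF
        assms[unfolded has_vector_derivative_def] V_has_derivative]]) (auto simp: mult.commute)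

lemma V'_odd: "V' (- q) = - V' q"
proof -
  have "((\<lambda>x. V (- x)) has_derivative (\<lambda>v. V' (- q) \<bullet> (- v))) (at q)"
    by (rule has_derivative_compose[OF _ V_has_derivative]) (auto intro!: derivative_eq_intros)
  then have "(V has_derivative (\<lambda>v. V' (- q) \<bullet> (- v))) (at q)"
    by (simp add: even)
  then have "(\<lambda>v. V' (- q) \<bullet> (- v)) = (\<lambda>v. V' q \<bullet> v)"
    by (rule has_derivative_unique[OF _ V_has_derivative])
  then have "- V' (- q) \<bullet> v = V' q \<bullet> v" for v
    by (metis inner_minus_left inner_minus_right)
  then have "- V' (- q) = V' q" using vector_eq_rdot by blast
  then show ?thesis by (metis minus_minus)
qed

text \<open>
The derivative of \<open>s\<^sup>2 (h - V (s q))\<close> is \<open>2 s (h - G (s q))\<close>; so \<open>G\<close> decides where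
the Maupertuis functional increases along a ray.
\<close>

definition G :: "'a \<Rightarrow> real" where
  "G q = V q + V' q \<bullet> q / 2"

lemma continuous_G: "continuous_on A G"
  unfolding G_def by (intro continuous_intros continuous_V continuous_V') auto

lemma G_0_less: "G 0 < h"
proof -
  have "\<mu>\<^sub>1 * V 0 < \<mu>\<^sub>1 * h" using growth[of 0] level by simp
  then show ?thesis using \<mu>\<^sub>1_pos by (simp add: G_def)
qed

lemma G_far:
  assumes "R \<le> norm q"
  shows "h + (\<mu>\<^sub>1 * h - \<mu>\<^sub>2) / 2 \<le> G q"
proof -
  have "h \<le> V q" by (rule far[OF assms])
  moreover from this have "\<mu>\<^sub>1 * h \<le> \<mu>\<^sub>1 * V q" using \<mu>\<^sub>1_pos by simp
  ultimately show ?thesis unfolding G_def using growth[of q] by (simp add: field_simps)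
qed

text \<open>
By Rolle's theorem and the nondegeneracy hypothesis, \<open>G\<close> is injective on the closed ray through \<open>q\<close>, hence strictly
monotone there. It increases because it is below \<open>h\<close> at the origin and above \<open>h\<close> far away.
\<close>

lemma G_strict_on_rays:
  assumes q: "q \<noteq> 0" and st: "0 \<le> s" "s < t"
  shows "G (s *\<^sub>R q) < G (t *\<^sub>R q)"
proof -
  define g where "g s = G (s *\<^sub>R q)" for s
  have cont: "continuous_on A g" for A
    unfolding g_def by (intro continuous_on_compose2[OF continuous_G[of UNIV]] continuous_intros) auto
  have der: "(g has_real_derivative
      (3 * (V' (s *\<^sub>R q) \<bullet> (s *\<^sub>R q)) + V'' (s *\<^sub>R q) (s *\<^sub>R q) \<bullet> (s *\<^sub>R q)) / (2 * s)) (at s)"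
    if s: "s > 0" for s
  proof -
    have line: "((\<lambda>s. s *\<^sub>R q) has_vector_derivative q) (at s)"
      by (auto intro!: derivative_eq_intros)
    interpret V'': bounded_linear "V'' (s *\<^sub>R q)" by (rule has_derivative_bounded_linear[OF hessian])
    have "((\<lambda>s. V' (s *\<^sub>R q)) has_derivative (\<lambda>d. V'' (s *\<^sub>R q) (d *\<^sub>R q))) (at s)"
      by (rule has_derivative_compose[OF line[unfolded has_vector_derivative_def] hessian])
    then have "((\<lambda>s. V' (s *\<^sub>R q) \<bullet> (s *\<^sub>R q)) has_derivative
        (\<lambda>d. V' (s *\<^sub>R q) \<bullet> (d *\<^sub>R q) + V'' (s *\<^sub>R q) (d *\<^sub>R q) \<bullet> (s *\<^sub>R q))) (at s)"
      by (rule has_derivative_inner[OF _ line[unfolded has_vector_derivative_def]])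
    then have "((\<lambda>s. V' (s *\<^sub>R q) \<bullet> (s *\<^sub>R q)) has_real_derivative
        (V' (s *\<^sub>R q) \<bullet> q + V'' (s *\<^sub>R q) q \<bullet> (s *\<^sub>R q))) (at s)"
      unfolding has_field_derivative_def
      by (rule has_derivative_eq_rhs) (auto simp: V''.scaleR algebra_simps)
    from DERIV_add[OF DERIV_V_along[OF line] DERIV_cdivide[OF this, of 2]]
    have "(g has_real_derivative V' (s *\<^sub>R q) \<bullet> q
        + (V' (s *\<^sub>R q) \<bullet> q + V'' (s *\<^sub>R q) q \<bullet> (s *\<^sub>R q)) / 2) (at s)"
      by (simp add: g_def[abs_def] G_def)
    then show ?thesis
      by (rule DERIV_cong) (use s in \<open>simp add: V''.scaleR field_simps\<close>)
  qed
  have inj: "g a \<noteq> g b" if ab: "0 \<le> a" "a < b" for a b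
  proof
    assume "g a = g b"
    then obtain z where z: "a < z" "z < b" "(g has_real_derivative 0) (at z)"
      using Rolle[OF ab(2) _ cont] der ab
      by (metis order.strict_trans1 real_differentiable_def)
    with DERIV_unique[OF der z(3)] ab nondegenerate[of "z *\<^sub>R q"] q show False by auto
  qed
  define T where "T = max (t + 1) (R / norm q)"
  have T: "T > t" "R \<le> norm (T *\<^sub>R q)"
    using q st by (auto simp: T_def max_def divide_le_eq mult.commute split: if_splits)
      (smt (verit) divide_le_eq mult.commute zero_less_norm_iff)
  have injT: "inj_on g {0..b}" for b
    using inj by (intro linorder_inj_onI) auto
  have "G 0 < G (T *\<^sub>R q)" using G_0_less G_far[OF T(2)] level by (simp add: field_simps)
  then have "g 0 < g T" by (simp add: g_def)
  then have "g 0 < g t \<and> g t < g T"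
    using continuous_inj_imp_mono[OF _ T(1) cont injT, of ] st by fastforce
  moreover have "s = 0 \<or> g 0 < g s \<and> g s < g t \<or> g t < g s \<and> g s < g 0"
    using continuous_inj_imp_mono[OF _ st(2) cont injT] st by fastforce
  ultimately show ?thesis by (auto simp: g_def)
qed

lemma G_0_le: "G 0 \<le> G q"
  using G_strict_on_rays[of q 0 1] by (cases "q = 0") auto

lemma depth_bounded: obtains m where "m > 0" "\<And>q. h - V q \<le> m"
proof -
  have "compact (V ` cball 0 R)"
    by (intro compact_continuous_image continuous_V compact_cball)
  then have "bounded (V ` cball 0 R)" by (rule compact_imp_bounded)
  then obtain B where B: "\<And>q. norm q \<le> R \<Longrightarrow> \<bar>V q\<bar> \<le> B"
    by (fastforce simp: bounded_iff)
  have "h - V q \<le> max 1 (h + B)" for q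
    using B[of q] far[of q] by (cases "R \<le> norm q") auto
  then show thesis by (intro that[of "max 1 (h + B)"]) auto
qed

subsection \<open>The discrete variational problem\<close>

text \<open>
Up to powers of \<open>N\<close>, \<open>kin\<close> and \<open>pot\<close> are the two factors of the Maupertuis functional of a loop that
is sampled at \<open>N\<close> points per half period.
\<close>

definition kin :: "nat \<Rightarrow> (int \<Rightarrow> 'a) \<Rightarrow> real" where
  "kin N u = (\<Sum>k<N. (norm (u (int k + 1) - u (int k)))\<^sup>2)"

definition pot :: "nat \<Rightarrow> (int \<Rightarrow> 'a) \<Rightarrow> real" where
  "pot N u = (\<Sum>k<N. h - V (u (int k)))"

text \<open>
The Nehari-type constraint: \<open>s = 1\<close> is a critical point of \<open>s \<mapsto> kin N (s u) * pot N (s u)\<close>.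
\<close>

definition admissible :: "nat \<Rightarrow> (int \<Rightarrow> 'a) \<Rightarrow> bool" where
  "admissible N u \<longleftrightarrow> antiperiodic N u \<and> (\<Sum>k<N. G (u (int k)) - h) = 0"

definition \<beta> :: real where "\<beta> = (\<mu>\<^sub>1 * h - \<mu>\<^sub>2) / (2 + \<mu>\<^sub>1)"

lemma \<beta>_pos: "\<beta> > 0" using level \<mu>\<^sub>1_pos by (simp add: \<beta>_def)

lemma kin_nonneg: "kin N u \<ge> 0" by (simp add: kin_def sum_nonneg)

text \<open>
The growth hypothesis gives \<open>2 G \<ge> (2 + \<mu>\<^sub>1) V - \<mu>\<^sub>2\<close>, and \<open>G\<close> has mean \<open>h\<close> on an admissible
sequence; this bounds the mean of \<open>V\<close> away from \<open>h\<close>, with gap \<open>\<beta>\<close>.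
\<close>

lemma pot_lower:
  assumes "admissible N u"
  shows "\<beta> * N \<le> pot N u"
proof -
  have "0 = (\<Sum>k<N. 2 * (G (u (int k)) - h))"
    using assms by (simp only: admissible_def sum_distrib_left[symmetric])
  also have "\<dots> \<ge> (\<Sum>k<N. (\<mu>\<^sub>1 * h - \<mu>\<^sub>2) - (2 + \<mu>\<^sub>1) * (h - V (u (int k))))"
  proof (rule sum_mono)
    fix k
    show "(\<mu>\<^sub>1 * h - \<mu>\<^sub>2) - (2 + \<mu>\<^sub>1) * (h - V (u (int k))) \<le> 2 * (G (u (int k)) - h)"
      using growth[of "u (int k)"] by (simp add: G_def algebra_simps)
  qed
  finally have "(\<mu>\<^sub>1 * h - \<mu>\<^sub>2) * N \<le> (2 + \<mu>\<^sub>1) * pot N u"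
    by (simp add: sum_subtractf pot_def mult.commute sum_distrib_left[symmetric])
  then show ?thesis using \<mu>\<^sub>1_pos by (simp add: \<beta>_def field_simps)
qed

lemma kin_le:
  assumes "admissible N u" "kin N u * pot N u \<le> F"
  shows "N * kin N u \<le> F / \<beta>"
proof -
  have "kin N u * (\<beta> * N) \<le> F"
    using mult_left_mono[OF pot_lower[OF assms(1)] kin_nonneg] assms(2) by (rule order_trans)
  then show ?thesis using \<beta>_pos by (simp add: field_simps)
qed

text \<open>
A minimising sequence is bounded: \<open>pot_lower\<close> turns the bound on the product into one on \<open>kin\<close>,
and antiperiodicity turns this into one on the values. As only finitely many values enter the
sums, pointwise convergence of a subsequence suffices.
\<close>

lemma minimizer_exists:
  assumes N: "N > 0" and ne: "admissible N u\<^sub>0"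
  obtains u where "admissible N u"
    "\<And>w. admissible N w \<Longrightarrow> kin N u * pot N u \<le> kin N w * pot N w"
proof -
  let ?F = "\<lambda>u. kin N u * pot N u"
  have nonneg: "0 \<le> ?F w" if "admissible N w" for w
    using pot_lower[OF that] \<beta>_pos kin_nonneg[of N w]
    by (meson mult_nonneg_nonneg of_nat_0_le_iff less_imp_le order_trans)
  define I where "I = Inf (?F ` Collect (admissible N))"
  have bdd: "bdd_below (?F ` Collect (admissible N))" using nonneg by (auto intro!: bdd_belowI[of _ 0])
  have I_le: "I \<le> ?F w" if "admissible N w" for w
    unfolding I_def using bdd that by (auto intro: cInf_lower)
  have "\<exists>w. admissible N w \<and> ?F w < I + 1 / real (Suc m)" for m
    using cInf_lessD[of "?F ` Collect (admissible N)" "I + 1 / real (Suc m)"] ne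
    by (auto simp: I_def)
  then obtain x where x: "\<And>m. admissible N (x m)" "\<And>m. ?F (x m) < I + 1 / real (Suc m)"
    by metis
  have "norm (x m k) \<le> sqrt ((I + 1) / \<beta>)" for m k
  proof (rule real_le_rsqrt)
    have "1 / real (Suc m) \<le> 1" by simp
    then have "?F (x m) \<le> I + 1" using x(2)[of m] by linarith
    then have "N * kin N (x m) \<le> (I + 1) / \<beta>" by (rule kin_le[OF x(1)])
    moreover have "4 * (norm (x m k))\<^sup>2 \<le> N * kin N (x m)"
      using x(1)[of m] antiperiodic_norm_sq_le unfolding admissible_def kin_def by blast
    ultimately show "(norm (x m k))\<^sup>2 \<le> (I + 1) / \<beta>" using zero_le_power2[of "norm (x m k)"] by linarith
  qed
  then obtain r where r: "strict_mono (r :: nat \<Rightarrow> nat)" "\<And>k. \<exists>l. (\<lambda>n. x (r n) k) \<longlonglongrightarrow> l"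
    using function_convergent_subsequence[of "UNIV :: int set" x] by (metis UNIV_I countableI_type)
  then obtain u where u: "\<And>k. (\<lambda>n. x (r n) k) \<longlonglongrightarrow> u k" by metis
  have "admissible N u"
    unfolding admissible_def antiperiodic_def
  proof (intro conjI allI)
    fix k
    have "(\<lambda>n. x (r n) (k + int N)) \<longlonglongrightarrow> - u k"
      using tendsto_minus[OF u[of k]] x(1) by (simp add: admissible_def antiperiodicD)
    then show "u (k + int N) = - u k" using u LIMSEQ_unique by blast
    have "(\<lambda>n. \<Sum>k<N. G (x (r n) (int k)) - h) \<longlonglongrightarrow> (\<Sum>k<N. G (u (int k)) - h)"
      by (intro tendsto_intros continuous_on_tendsto_compose[OF continuous_G[of UNIV]] u) auto
    then show "(\<Sum>k<N. G (u (int k)) - h) = 0"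
      using x(1) by (simp add: admissible_def LIMSEQ_const_iff)
  qed
  moreover have "?F u \<le> I"
  proof (rule LIMSEQ_le)
    show "(\<lambda>n. ?F (x (r n))) \<longlonglongrightarrow> ?F u"
      unfolding kin_def pot_def
      by (intro tendsto_intros continuous_on_tendsto_compose[OF continuous_V[of UNIV]] u) auto
    show "(\<lambda>n. I + 1 / real (Suc (r n))) \<longlonglongrightarrow> I"
      using LIMSEQ_subseq_LIMSEQ[OF tendsto_add[OF tendsto_const LIMSEQ_Suc[OF lim_1_over_n]] r(1), of I]
      by (simp add: o_def)
  qed (use x(2) in \<open>auto intro: less_imp_le\<close>)
  ultimately show thesis using that I_le order_trans by blast
qed

text \<open>
The left-hand side \<open>c k\<close> of the equation is, up to sign, the gradient of the functional with respect to \<open>u k\<close>.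
Because \<open>V'\<close> is odd, \<open>c\<close> is itself antiperiodic and may serve as the direction of variation. The derivative of the
functional in this direction is \<open>- \<Sum>|c k|\<^sup>2\<close>, and it cannot be negative.
\<close>

lemma minimizer_critical:
  assumes N: "N > 0" and u: "admissible N u"
    and minimal: "\<And>w. admissible N w \<Longrightarrow> kin N u * pot N u \<le> kin N w * pot N w"
  shows "kin N u *\<^sub>R V' (u k) + (2 * pot N u) *\<^sub>R (u (k + 1) - 2 *\<^sub>R u k + u (k - 1)) = 0"
proof -
  define c where
    "c k = kin N u *\<^sub>R V' (u k) + (2 * pot N u) *\<^sub>R (u (k + 1) - 2 *\<^sub>R u k + u (k - 1))" for k
  have ap: "antiperiodic N u" using u by (simp add: admissible_def)
  have apc: "antiperiodic N c"
    unfolding antiperiodic_def c_def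
    using antiperiodicD[OF ap] antiperiodicD[OF ap, of "_ + 1"] antiperiodicD[OF ap, of "_ - 1"]
    by (simp add: V'_odd algebra_simps)
  define x where "x s e k = s *\<^sub>R (u k + e *\<^sub>R c k)" for s e :: real and k
  have apx: "antiperiodic N (x s e)" for s e
    using ap apc by (simp add: antiperiodic_def x_def algebra_simps)
  define b where "b = (\<Sum>k<N. (u (int k + 1) - u (int k)) \<bullet> (c (int k + 1) - c (int k)))"
  have norm_sq_add: "(norm (v + e *\<^sub>R w))\<^sup>2 = (norm v)\<^sup>2 + 2 * e * (v \<bullet> w) + e\<^sup>2 * (norm w)\<^sup>2"
    for v w :: 'a and e
    unfolding power2_norm_eq_inner
    by (simp add: inner_add_left inner_add_right inner_commute power2_eq_square)
  have kin_x: "kin N (x s e) = s\<^sup>2 * (kin N u + 2 * e * b + e\<^sup>2 * kin N c)" for s e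
  proof -
    have "(norm (x s e (k + 1) - x s e k))\<^sup>2 = s\<^sup>2 * ((norm (u (k + 1) - u k))\<^sup>2
        + 2 * e * ((u (k + 1) - u k) \<bullet> (c (k + 1) - c k)) + e\<^sup>2 * (norm (c (k + 1) - c k))\<^sup>2)" for k
    proof -
      have eq: "x s e (k + 1) - x s e k = s *\<^sub>R ((u (k + 1) - u k) + e *\<^sub>R (c (k + 1) - c k))"
        by (simp add: x_def algebra_simps)
      show ?thesis unfolding eq norm_scaleR power_mult_distrib
        unfolding norm_sq_add by (simp add: algebra_simps)
    qed
    then have "kin N (x s e) = (\<Sum>k<N. s\<^sup>2 * ((norm (u (int k + 1) - u (int k)))\<^sup>2
        + 2 * e * ((u (int k + 1) - u (int k)) \<bullet> (c (int k + 1) - c (int k)))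
        + e\<^sup>2 * (norm (c (int k + 1) - c (int k)))\<^sup>2))"
      unfolding kin_def by (intro sum.cong) simp_all
    also have "\<dots> = s\<^sup>2 * (kin N u + 2 * e * b + e\<^sup>2 * kin N c)"
      by (simp only: sum_distrib_left[symmetric] sum.distrib kin_def b_def)
    finally show ?thesis .
  qed
  define \<gamma> where "\<gamma> s e = (\<Sum>k<N. G (x s e (int k)) - h)" for s e
  define \<psi> where "\<psi> s e = kin N (x s e) * pot N (x s e)" for s e
  define P where "P s e = (\<Sum>k<N. - (V' (x s e (int k)) \<bullet> (s *\<^sub>R c (int k))))" for s e
  define \<psi>' where "\<psi>' s e = (s\<^sup>2 * (2 * b + 2 * e * kin N c)) * pot N (x s e) + kin N (x s e) * P s e" for s e
  \<comment> \<open>The zero sequence violates the constraint, as G 0 < h; so the ray through u is not a point.\<close>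
  have u0: "\<exists>k<N. u (int k) \<noteq> 0"
  proof (rule ccontr)
    assume "\<not> ?thesis"
    then have "(\<Sum>k<N. G (u (int k)) - h) = N * (G 0 - h)" by simp
    with u N G_0_less show False by (simp add: admissible_def)
  qed
  have x10: "x 1 0 = u" by (simp add: x_def fun_eq_iff)
  have \<gamma>1: "\<gamma> 1 0 = 0" using u by (simp add: \<gamma>_def x10 admissible_def)
  have \<gamma>_mono: "\<gamma> s 0 < \<gamma> t 0" if st: "0 \<le> s" "s < t" for s t
    unfolding \<gamma>_def
  proof (rule sum_strict_mono_ex1)
    have strict: "G (x s 0 (int k)) < G (x t 0 (int k))" if "u (int k) \<noteq> 0" for k
      using G_strict_on_rays[OF that st] by (simp add: x_def)
    have weak: "G (x s 0 (int k)) \<le> G (x t 0 (int k))" for k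
      using strict[of k] by (cases "u (int k) = 0") (auto simp: x_def)
    show "\<forall>k\<in>{..<N}. G (x s 0 (int k)) - h \<le> G (x t 0 (int k)) - h"
      using weak by simp
    show "\<exists>k\<in>{..<N}. G (x s 0 (int k)) - h < G (x t 0 (int k)) - h"
      using strict u0 by auto
  qed simp
  have "0 \<le> \<psi>' 1 0"
  proof (rule constrained_minimum_derivative_nonneg[of \<gamma> \<psi>])
    show "continuous_on UNIV (\<lambda>s. \<gamma> s e)" "continuous_on UNIV (\<gamma> s)" for s e
      unfolding \<gamma>_def x_def
      by (intro continuous_intros continuous_on_compose2[OF continuous_G[of UNIV]]; simp)+
    show "\<gamma> s 0 < 0" if "0 < s" "s < 1" for s using \<gamma>_mono[of s 1] that \<gamma>1 by simp
    show "0 < \<gamma> s 0" if "1 < s" for s using \<gamma>_mono[of 1 s] that \<gamma>1 by simp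
    show "continuous_on UNIV (\<lambda>(s, e). \<psi>' s e)"
      unfolding \<psi>'_def kin_x P_def pot_def x_def case_prod_unfold
      by (intro continuous_intros continuous_on_compose2[OF continuous_V[of UNIV]]
          continuous_on_compose2[OF continuous_V'[of UNIV]]; simp)
    show "\<psi> 1 0 \<le> \<psi> s e" if "0 < s" "\<gamma> s e = 0" for s e
      using minimal[of "x s e"] that apx by (simp add: \<psi>_def x10 admissible_def \<gamma>_def)
    show "(\<psi> s has_real_derivative \<psi>' s e) (at e)" for s e
    proof -
      have K: "((\<lambda>e. kin N (x s e)) has_real_derivative s\<^sup>2 * (2 * b + 2 * e * kin N c)) (at e)"
        unfolding kin_x by (auto intro!: derivative_eq_intros)
      have line: "((\<lambda>e. x s e k) has_vector_derivative s *\<^sub>R c k) (at e)" for k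
        unfolding x_def by (auto intro!: derivative_eq_intros)
      have Q: "((\<lambda>e. pot N (x s e)) has_real_derivative P s e) (at e)"
        unfolding pot_def P_def
        by (intro DERIV_sum) (auto intro!: derivative_eq_intros DERIV_V_along[OF line])
      show ?thesis
        using DERIV_mult[OF K Q] by (simp add: \<psi>_def[abs_def] \<psi>'_def algebra_simps)
    qed
    show "\<psi> s 0 \<le> \<psi> 1 0" if s: "0 < s" for s
    proof -
      \<comment> \<open>Along the ray kin is quadratic, so the functional is a multiple of g, which increases up to
        s = 1 and decreases afterwards.\<close>
      define g where "g s = s\<^sup>2 * pot N (x s 0)" for s
      have der: "(g has_real_derivative - 2 * s * \<gamma> s 0) (at s)" for s
      proof -
        have line: "((\<lambda>s. x s 0 k) has_vector_derivative u k) (at s)" for k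
          unfolding x_def by (auto intro!: derivative_eq_intros)
        have Q: "((\<lambda>s. pot N (x s 0)) has_real_derivative (\<Sum>k<N. - (V' (x s 0 (int k)) \<bullet> u (int k)))) (at s)"
          unfolding pot_def
          by (intro DERIV_sum) (auto intro!: derivative_eq_intros DERIV_V_along[OF line])
        have "(g has_real_derivative 2 * s * pot N (x s 0)
            + s\<^sup>2 * (\<Sum>k<N. - (V' (x s 0 (int k)) \<bullet> u (int k)))) (at s)"
          unfolding g_def by (rule derivative_eq_intros Q refl | simp)+
        moreover have "2 * s * pot N (x s 0) + s\<^sup>2 * (\<Sum>k<N. - (V' (x s 0 (int k)) \<bullet> u (int k)))
            = - 2 * s * \<gamma> s 0"
          unfolding pot_def \<gamma>_def sum_distrib_left sum.distrib[symmetric]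
          by (intro sum.cong) (auto simp: G_def x_def algebra_simps power2_eq_square)
        ultimately show ?thesis by simp
      qed
      have "g s \<le> g 1"
      proof (cases "s \<le> 1")
        case True
        show ?thesis
        proof (rule DERIV_nonneg_imp_nondecreasing[OF True])
          fix z assume z: "s \<le> z" "z \<le> 1"
          then have "\<gamma> z 0 \<le> 0" using \<gamma>_mono[of z 1] \<gamma>1 s by (cases "z = 1") auto
          then have "0 \<le> - 2 * z * \<gamma> z 0" using z s by (simp add: mult_nonneg_nonpos)
          then show "\<exists>y. (g has_real_derivative y) (at z) \<and> 0 \<le> y" using der by blast
        qed
      next
        case False
        show ?thesis
        proof (rule DERIV_nonpos_imp_nonincreasing[of 1 s g])
          show "1 \<le> s" using False by simp
          fix z assume z: "1 \<le> z" "z \<le> s"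
          then have "0 \<le> \<gamma> z 0" using \<gamma>_mono[of 1 z] \<gamma>1 by (cases "z = 1") auto
          then have "- 2 * z * \<gamma> z 0 \<le> 0" using z by simp
          then show "\<exists>y. (g has_real_derivative y) (at z) \<and> y \<le> 0" using der by blast
        qed
      qed
      then have "kin N u * g s \<le> kin N u * g 1" by (rule mult_left_mono[OF _ kin_nonneg])
      then show ?thesis by (simp add: \<psi>_def g_def kin_x algebra_simps)
    qed
  qed
  also have "\<psi>' 1 0 = - (\<Sum>k<N. (norm (c (int k)))\<^sup>2)"
  proof -
    define L where "L k = u (int k + 1) - 2 *\<^sub>R u (int k) + u (int k - 1)" for k
    have c_eq: "c (int k) = kin N u *\<^sub>R V' (u (int k)) + (2 * pot N u) *\<^sub>R L k" for k
      by (simp add: c_def L_def)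
    have "b = - (\<Sum>k<N. L k \<bullet> c (int k))"
      unfolding b_def L_def by (rule antiperiodic_summation_by_parts[OF ap apc])
    then have "\<psi>' 1 0 = 2 * pot N u * (- (\<Sum>k<N. L k \<bullet> c (int k)))
        + kin N u * (\<Sum>k<N. - (V' (u (int k)) \<bullet> c (int k)))"
      unfolding \<psi>'_def P_def x10 by simp
    also have "\<dots> = - (\<Sum>k<N. (kin N u *\<^sub>R V' (u (int k)) + (2 * pot N u) *\<^sub>R L k) \<bullet> c (int k))"
      unfolding inner_add_left inner_scaleR_left sum.distrib sum_negf sum_distrib_left[symmetric]
      by simp
    also have "\<dots> = - (\<Sum>k<N. (norm (c (int k)))\<^sup>2)"
      by (simp only: c_eq[symmetric] power2_norm_eq_inner)
    finally show ?thesis .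
  qed
  finally have "(\<Sum>k<N. (norm (c (int k)))\<^sup>2) = 0"
    by (intro antisym sum_nonneg) auto
  then have zero: "c (int k) = 0" if "k < N" for k
    using that by (subst (asm) sum_nonneg_eq_0_iff) auto
  have "c (int k + 1) = 0" if "k < N" for k
  proof (cases "Suc k < N")
    case True
    then show ?thesis using zero[of "Suc k"] by (simp add: add.commute)
  next
    case False
    then have "int k + 1 = 0 + int N" using that by simp
    then show ?thesis using antiperiodicD[OF apc, of 0] zero[of 0] N by simp
  qed
  with zero have "4 * (norm (c k))\<^sup>2 \<le> 0"
    using antiperiodic_norm_sq_le[OF apc, of k] by simp
  then show ?thesis by (simp add: c_def)
qed

lemma card_near_midpoint:
  assumes N: "N > 0" and \<delta>: "\<delta> > 0"
  shows "real (card {k. k < N \<and> \<bar>1 - 2 * real k / real N\<bar> < \<delta>}) \<le> \<delta> * N + 1"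
proof -
  let ?a = "real N * (1 - \<delta>) / 2" and ?b = "real N * (1 + \<delta>) / 2"
  let ?A = "{k. k < N \<and> \<bar>1 - 2 * real k / real N\<bar> < \<delta>}"
  have "int ` ?A \<subseteq> {\<lceil>?a\<rceil>..\<lfloor>?b\<rfloor>}"
  proof
    fix z assume "z \<in> int ` ?A"
    then obtain k where k: "z = int k" "\<bar>1 - 2 * real k / real N\<bar> < \<delta>" by auto
    have "?a \<le> real k" "real k \<le> ?b" using k(2) N by (auto simp: field_simps abs_less_iff)
    then show "z \<in> {\<lceil>?a\<rceil>..\<lfloor>?b\<rfloor>}" using k(1) by (auto simp: ceiling_le_iff le_floor_iff)
  qed
  then have "card ?A \<le> nat (\<lfloor>?b\<rfloor> - \<lceil>?a\<rceil> + 1)"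
    using card_mono[of "{\<lceil>?a\<rceil>..\<lfloor>?b\<rfloor>}" "int ` ?A"] by (simp add: card_image)
  also have "real \<dots> \<le> max 0 (?b - ?a + 1)" by linarith
  also have "\<dots> = \<delta> * N + 1" using \<delta> by (simp add: field_simps max_def)
  finally show ?thesis by simp
qed

text \<open>
A bound on the minimum that does not depend on \<open>N\<close>. The test loop \<open>\<tau> k e\<close> moves along a segment at
constant speed, from \<open>e\<close> to \<open>- e\<close> in half a period. After scaling by a large \<open>S\<close> it lies outside the ball of radius \<open>R\<close>,
where \<open>G - h \<ge> c\<close>, except for a fraction of at most about \<open>\<delta>\<close> of the times, where still \<open>G - h \<ge> - d\<close>. Hence the
constraint function is positive at \<open>S\<close>, it is negative at \<open>0\<close>, and an
admissible multiple of the test loop has a factor in \<open>[0, S]\<close>.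
\<close>

lemma admissible_bounded_exists:
  obtains F N\<^sub>0 where "\<And>N. N\<^sub>0 \<le> N \<Longrightarrow> \<exists>u. admissible N u \<and> kin N u * pot N u \<le> F"
proof -
  obtain m where m: "m > 0" "\<And>q. h - V q \<le> m" by (rule depth_bounded) blast
  obtain e :: 'a where e: "norm e = 1" using vector_choose_size[of 1] by auto
  define c where "c = (\<mu>\<^sub>1 * h - \<mu>\<^sub>2) / 2"
  define d where "d = h - G 0"
  have c: "c > 0" using level by (simp add: c_def)
  have d: "d > 0" using G_0_less by (simp add: d_def)
  \<comment> \<open>Times with |\<tau>| < \<delta> lose at most (c + d)(\<delta> N + 1) from the total c N; with this \<delta> the first
    part of the loss is c N / 4, and the second is no larger once N is at least N0.\<close>
  define \<delta> where "\<delta> = c / (4 * (c + d))"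
  have \<delta>: "\<delta> > 0" using c d by (simp add: \<delta>_def)
  define S where "S = max R 1 / \<delta>"
  have S: "S > 0" "\<delta> * S \<ge> R" using \<delta> by (auto simp: S_def)
  define N\<^sub>0 where "N\<^sub>0 = nat \<lceil>4 * (c + d) / c\<rceil> + 1"
  have "\<exists>u. admissible N u \<and> kin N u * pot N u \<le> 4 * S\<^sup>2 * m" if "N\<^sub>0 \<le> N" for N
  proof -
    have N: "N > 0" "4 * (c + d) / c \<le> N" using that unfolding N\<^sub>0_def by linarith+
    define \<tau> where "\<tau> k = 1 - 2 * real k / real N" for k
    obtain w where w: "antiperiodic N w" "\<And>k. k < N \<Longrightarrow> w (int k) = \<tau> k *\<^sub>R e"
      by (rule antiperiodic_extension[OF N(1), of "\<lambda>k. \<tau> k *\<^sub>R e"]) blast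
    have wSuc: "w (int k + 1) = \<tau> (Suc k) *\<^sub>R e" if "k < N" for k
    proof (cases "Suc k < N")
      case True
      then show ?thesis using w(2)[of "Suc k"] by (simp add: add.commute)
    next
      case False
      then have "N = Suc k" using that by simp
      then have "int k + 1 = 0 + int N" "\<tau> (Suc k) = - 1" by (simp_all add: \<tau>_def del: of_nat_Suc)
      then show ?thesis using antiperiodicD[OF w(1), of 0] w(2)[of 0] N by (simp add: \<tau>_def)
    qed
    have kinw: "kin N w = 4 / N"
    proof -
      have "(norm (w (int k + 1) - w (int k)))\<^sup>2 = 4 / (real N)\<^sup>2" if "k < N" for k
      proof -
        have "w (int k + 1) - w (int k) = (- 2 / real N) *\<^sub>R e"
          using w(2)[OF that] wSuc[OF that] N by (simp add: \<tau>_def field_simps flip: scaleR_left_diff_distrib)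
        then show ?thesis using e by (simp add: power_divide)
      qed
      then have "kin N w = (\<Sum>k<N. 4 / (real N)\<^sup>2)" unfolding kin_def by (intro sum.cong) auto
      then show ?thesis using N by (simp add: power2_eq_square)
    qed
    define g where "g s = (\<Sum>k<N. G (s *\<^sub>R w (int k)) - h)" for s
    have "g 0 < 0" using N d by (simp add: g_def d_def mult_pos_neg)
    moreover have "0 < g S"
    proof -
      let ?B = "{k. k < N \<and> \<bar>1 - 2 * real k / real N\<bar> < \<delta>}"
      have "c * N - (c + d) * card ?B = (\<Sum>k<N. if k \<in> ?B then - d else c)"
      proof -
        have sub: "?B \<subseteq> {..<N}" by auto
        have "(\<Sum>k<N. if k \<in> ?B then - d else c) = (\<Sum>k<N. c - (if k \<in> ?B then c + d else 0))"
          by (intro sum.cong) auto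
        also have "\<dots> = c * N - (\<Sum>k\<in>?B. c + d)"
          using sum.mono_neutral_right[OF _ sub, of "\<lambda>k. if k \<in> ?B then c + d else 0"]
          by (simp add: sum_subtractf)
        finally show ?thesis by (simp add: mult.commute)
      qed
      also have "\<dots> \<le> g S"
        unfolding g_def
      proof (rule sum_mono)
        fix k assume k: "k \<in> {..<N}"
        show "(if k \<in> ?B then - d else c) \<le> G (S *\<^sub>R w (int k)) - h"
        proof (cases "k \<in> ?B")
          case True
          then show ?thesis using G_0_le[of "S *\<^sub>R w (int k)"] by (simp add: d_def)
        next
          case False
          then have "\<delta> \<le> \<bar>\<tau> k\<bar>" using k by (auto simp: \<tau>_def)
          then have "\<delta> * S \<le> \<bar>\<tau> k\<bar> * S" using S by (intro mult_right_mono) auto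
          then have "R \<le> \<bar>\<tau> k\<bar> * S" using S(2) by linarith
          also have "\<dots> = norm (S *\<^sub>R w (int k))" using S(1) w(2)[of k] k e by (simp add: abs_mult mult.commute)
          finally have "h + c \<le> G (S *\<^sub>R w (int k))" unfolding c_def by (rule G_far)
          then show ?thesis unfolding if_not_P[OF False] by simp
        qed
      qed
      finally have "c * N - (c + d) * card ?B \<le> g S" .
      moreover have "(c + d) * card ?B \<le> (c + d) * (\<delta> * N + 1)"
        using card_near_midpoint[OF N(1) \<delta>] c d by (intro mult_left_mono) auto
      moreover have "(c + d) * (\<delta> * N + 1) = c * N / 4 + (c + d)"
      proof -
        have "(c + d) * \<delta> = c / 4" using c d by (simp add: \<delta>_def field_simps)
        then have "(c + d) * \<delta> * N = c / 4 * N" by simp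
        then show ?thesis by (simp add: algebra_simps)
      qed
      moreover have "c + d \<le> c * N / 4" using N(2) c by (simp add: field_simps)
      moreover have "0 < c * N" using c N by simp
      ultimately show ?thesis by linarith
    qed
    moreover have "continuous_on {0..S} g"
      unfolding g_def by (intro continuous_intros continuous_on_compose2[OF continuous_G[of UNIV]]) auto
    ultimately obtain s where s: "0 \<le> s" "s \<le> S" "g s = 0"
      using IVT'[of g 0 0 S] S by auto
    let ?u = "\<lambda>k. s *\<^sub>R w k"
    have adm: "admissible N ?u" using w(1) s(3) by (simp add: admissible_def antiperiodic_def g_def)
    have "kin N ?u = s\<^sup>2 * kin N w"
      by (simp add: kin_def power_mult_distrib sum_distrib_left flip: scaleR_right_diff_distrib)
    moreover have "s\<^sup>2 \<le> S\<^sup>2" using s by (intro power_mono) auto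
    ultimately have k: "kin N ?u \<le> S\<^sup>2 * (4 / N)" using kinw N by (simp add: divide_right_mono)
    have p: "pot N ?u \<le> m * N"
      using sum_mono[of "{..<N}" "\<lambda>k. h - V (?u (int k))" "\<lambda>_. m"] m by (simp add: pot_def mult.commute)
    have "kin N ?u * pot N ?u \<le> S\<^sup>2 * (4 / N) * (m * N)"
      using k p pot_lower[OF adm] \<beta>_pos by (intro mult_mono) (auto intro: order_trans[of _ "\<beta> * N"])
    also have "\<dots> = 4 * S\<^sup>2 * m" using N by simp
    finally show ?thesis using adm by blast
  qed
  then show thesis by (rule that)
qed

text \<open>
The number \<open>\<omega>\<close> is \<open>N\<^sup>2 * kin / (2 * pot)\<close>, so that criticality becomes the discrete equation of motion and the
mean energy is exact. Its upper bound comes from the test loop. Its lower bound comes from the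
constraint: a loop inside a small ball, where \<open>G < h\<close>, is not admissible, so the loop has a positive minimal size and
by the Poincare inequality a positive minimal \<open>kin\<close>.
\<close>

lemma discrete_solutions_exist:
  obtains C \<omega>\<^sub>0 \<omega>\<^sub>1 :: real and N\<^sub>0 where "0 < \<omega>\<^sub>0"
    "\<And>N. N\<^sub>0 \<le> N \<Longrightarrow> \<exists>u \<omega>. antiperiodic N u \<and> (\<forall>k. norm (u k) \<le> C) \<and> \<omega>\<^sub>0 \<le> \<omega> \<and> \<omega> \<le> \<omega>\<^sub>1 \<and>
      (\<forall>k. u (k + 1) - 2 *\<^sub>R u k + u (k - 1) = - (\<omega> / (real N)\<^sup>2) *\<^sub>R V' (u k)) \<and>
      (\<Sum>k<N. (norm (real N *\<^sub>R (u (int k + 1) - u (int k))))\<^sup>2 / 2 + \<omega> * V (u (int k)) - \<omega> * h) = 0"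
proof -
  obtain F N\<^sub>1 where F: "\<And>N. N\<^sub>1 \<le> N \<Longrightarrow> \<exists>u. admissible N u \<and> kin N u * pot N u \<le> F"
    by (rule admissible_bounded_exists) blast
  obtain m where m: "m > 0" "\<And>q. h - V q \<le> m" by (rule depth_bounded) blast
  have "\<forall>\<^sub>F q in nhds 0. G q < h"
    using continuous_G[of UNIV] G_0_less
    by (intro order_tendstoD(2)[where y = "G 0"])
       (auto simp: continuous_on_eq_continuous_at continuous_at tendsto_at_iff_tendsto_nhds)
  then obtain r where r: "r > 0" "\<And>q. norm q < r \<Longrightarrow> G q < h"
    unfolding eventually_nhds_metric by auto
  define C where "C = sqrt (F / \<beta>)"
  have "\<exists>u \<omega>. antiperiodic N u \<and> (\<forall>k. norm (u k) \<le> C) \<and> 2 * r\<^sup>2 / m \<le> \<omega> \<and> \<omega> \<le> F / (2 * \<beta>\<^sup>2) \<and>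
      (\<forall>k. u (k + 1) - 2 *\<^sub>R u k + u (k - 1) = - (\<omega> / (real N)\<^sup>2) *\<^sub>R V' (u k)) \<and>
      (\<Sum>k<N. (norm (real N *\<^sub>R (u (int k + 1) - u (int k))))\<^sup>2 / 2 + \<omega> * V (u (int k)) - \<omega> * h) = 0"
    if N1: "max 1 N\<^sub>1 \<le> N" for N
  proof -
    have N: "N > 0" using N1 by simp
    obtain u\<^sub>0 where u0: "admissible N u\<^sub>0" "kin N u\<^sub>0 * pot N u\<^sub>0 \<le> F" using F[of N] N1 by auto
    obtain u where u: "admissible N u"
      and min: "\<And>w. admissible N w \<Longrightarrow> kin N u * pot N u \<le> kin N w * pot N w"
      using minimizer_exists[OF N u0(1)] by blast
    define D where "D = kin N u"
    define S where "S = pot N u"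
    have ap: "antiperiodic N u" using u by (simp add: admissible_def)
    have S: "\<beta> * N \<le> S" using pot_lower[OF u] by (simp add: S_def)
    then have Spos: "S > 0" using \<beta>_pos N by (meson less_le_trans mult_pos_pos of_nat_0_less_iff)
    have S2: "S \<le> m * N"
      using sum_mono[of "{..<N}" "\<lambda>k. h - V (u (int k))" "\<lambda>_. m"] m by (simp add: S_def pot_def mult.commute)
    have ND: "N * D \<le> F / \<beta>"
      using kin_le[OF u] min[OF u0(1)] u0(2) by (simp add: D_def)
    have sq: "4 * (norm (u k))\<^sup>2 \<le> N * D" for k
      using antiperiodic_norm_sq_le[OF ap] by (simp add: D_def kin_def)
    have bound: "norm (u k) \<le> C" for k
      unfolding C_def by (rule real_le_rsqrt) (use sq[of k] ND zero_le_power2[of "norm (u k)"] in linarith)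
    have "\<exists>k<N. r \<le> norm (u (int k))"
    proof (rule ccontr)
      assume "\<not> ?thesis"
      then have "(\<Sum>k<N. G (u (int k)) - h) < (\<Sum>k<N. 0)"
        using r(2) N by (intro sum_strict_mono) (auto simp: not_le)
      then show False using u by (simp add: admissible_def)
    qed
    then obtain k where "r \<le> norm (u (int k))" by blast
    then have "r\<^sup>2 \<le> (norm (u (int k)))\<^sup>2" using r(1) by (intro power_mono) auto
    with sq[of "int k"] have r2: "4 * r\<^sup>2 \<le> N * D" by linarith
    then have ND0: "0 \<le> N * D" using zero_le_power2[of r] by linarith
    define \<omega> where "\<omega> = (real N)\<^sup>2 * D / (2 * S)"
    have "2 * r\<^sup>2 / m \<le> \<omega>"
    proof -
      have "2 * r\<^sup>2 / m = (4 * r\<^sup>2) * N / (2 * (m * N))" using N m by simp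
      also have "\<dots> \<le> (N * D) * N / (2 * S)"
        using r2 S2 Spos kin_nonneg by (intro frac_le mult_right_mono mult_nonneg_nonneg) (auto simp: D_def)
      also have "\<dots> = \<omega>" by (simp add: \<omega>_def power2_eq_square)
      finally show ?thesis .
    qed
    moreover have "\<omega> \<le> F / (2 * \<beta>\<^sup>2)"
    proof -
      have "\<omega> = (N * D) * N / (2 * S)" by (simp add: \<omega>_def power2_eq_square)
      also have "\<dots> \<le> (F / \<beta>) * N / (2 * (\<beta> * N))"
        using ND S \<beta>_pos N order_trans[OF ND0 ND]
        by (intro frac_le mult_right_mono mult_nonneg_nonneg) auto
      also have "\<dots> = F / (2 * \<beta>\<^sup>2)" using N by (simp add: power2_eq_square)
      finally show ?thesis .
    qed
    moreover have "u (k + 1) - 2 *\<^sub>R u k + u (k - 1) = - (\<omega> / (real N)\<^sup>2) *\<^sub>R V' (u k)" for k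
    proof -
      have "D *\<^sub>R V' (u k) + (2 * S) *\<^sub>R (u (k + 1) - 2 *\<^sub>R u k + u (k - 1)) = 0"
        using minimizer_critical[OF N u min] by (simp add: D_def S_def)
      then have "(2 * S) *\<^sub>R (u (k + 1) - 2 *\<^sub>R u k + u (k - 1)) = (2 * S) *\<^sub>R (- (D / (2 * S)) *\<^sub>R V' (u k))"
        using Spos by (simp add: add_eq_0_iff)
      then have "u (k + 1) - 2 *\<^sub>R u k + u (k - 1) = - (D / (2 * S)) *\<^sub>R V' (u k)"
        using Spos scaleR_cancel_left by (metis mult_eq_0_iff less_irrefl zero_neq_numeral)
      moreover have "\<omega> / (real N)\<^sup>2 = D / (2 * S)" using N by (simp add: \<omega>_def)
      ultimately show ?thesis by simp
    qed
    moreover have "(\<Sum>k<N. (norm (real N *\<^sub>R (u (int k + 1) - u (int k))))\<^sup>2 / 2 + \<omega> * V (u (int k)) - \<omega> * h)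
        = (real N)\<^sup>2 / 2 * D - \<omega> * S"
      unfolding D_def S_def kin_def pot_def sum_distrib_left sum_subtractf[symmetric] norm_scaleR power_mult_distrib
      by (intro sum.cong) (auto simp: algebra_simps)
    moreover have "(real N)\<^sup>2 / 2 * D - \<omega> * S = 0" using Spos by (simp add: \<omega>_def)
    ultimately show ?thesis using ap bound by (intro exI[of _ u] exI[of _ \<omega>]) auto
  qed
  moreover have "0 < 2 * r\<^sup>2 / m" using r m by simp
  ultimately show thesis using that by blast
qed

section \<open>Passage to the limit\<close>

lemma V_taylor:
  assumes lip: "L-lipschitz_on (cball 0 C) V'" and xy: "norm x \<le> C" "norm y \<le> C"
  shows "\<bar>V y - V x - V' y \<bullet> (y - x)\<bar> \<le> L * (norm (y - x))\<^sup>2"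
proof -
  have line: "((\<lambda>t. x + t *\<^sub>R (y - x)) has_vector_derivative y - x) (at t)" for t
    by (auto intro!: derivative_eq_intros)
  obtain t :: real where t: "0 < t" "t < 1"
    and eq: "V (x + 1 *\<^sub>R (y - x)) - V (x + 0 *\<^sub>R (y - x)) = (1 - 0) * (V' (x + t *\<^sub>R (y - x)) \<bullet> (y - x))"
    using MVT2[OF zero_less_one DERIV_V_along[OF line]] by blast
  define z where "z = x + t *\<^sub>R (y - x)"
  have "z = (1 - t) *\<^sub>R x + t *\<^sub>R y" by (simp add: z_def algebra_simps)
  then have z: "z \<in> cball 0 C"
    using convexD_alt[OF convex_cball[of 0 C], of x y t] xy t by simp
  have zy: "norm (z - y) \<le> norm (y - x)"
  proof -
    have "z - y = - (1 - t) *\<^sub>R (y - x)" by (simp add: z_def algebra_simps)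
    then have "norm (z - y) = (1 - t) * norm (y - x)" using t by simp
    also have "\<dots> \<le> 1 * norm (y - x)" using t by (intro mult_right_mono) auto
    finally show ?thesis by simp
  qed
  have "V y - V x - V' y \<bullet> (y - x) = (V' z - V' y) \<bullet> (y - x)"
    using eq by (simp add: z_def inner_diff_left)
  also have "\<bar>\<dots>\<bar> \<le> norm (V' z - V' y) * norm (y - x)" by (rule Cauchy_Schwarz_ineq2)
  also have "\<dots> \<le> (L * norm (z - y)) * norm (y - x)"
    using lipschitz_onD[OF lip z, of y] xy by (intro mult_right_mono) (auto simp: dist_norm)
  also have "\<dots> \<le> (L * norm (y - x)) * norm (y - x)"
    using zy lipschitz_on_nonneg[OF lip] by (intro mult_right_mono mult_left_mono) auto
  finally show ?thesis by (simp add: power2_eq_square mult.assoc)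
qed

text \<open>
The triples of position, velocity and frequency factor \<open>\<omega>\<close> are bounded and Lipschitz on the scale \<open>1 / N\<close>, so
a subsequence converges. The discrete energy drifts by \<open>O(1/N\<^sup>2)\<close> per step, hence by \<open>O(1/N)\<close> over a half
period; since its mean is \<open>\<omega> h\<close>, its initial value tends to \<open>w h\<close>. In the limit the energy is
conserved.
\<close>

lemma rescaled_solution_exists:
  obtains U P :: "real \<Rightarrow> 'a" and w :: real where "w > 0"
    "\<And>t. (U has_vector_derivative P t) (at t)"
    "\<And>t. (P has_vector_derivative - w *\<^sub>R V' (U t)) (at t)"
    "\<And>t. U (t + 1) = - U t"
    "\<And>t. (norm (P t))\<^sup>2 / 2 + w * V (U t) = w * h"
proof -
  obtain C \<omega>\<^sub>0 \<omega>\<^sub>1 :: real and N\<^sub>0 where \<omega>\<^sub>0: "0 < \<omega>\<^sub>0" and ex: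
    "\<And>N. N\<^sub>0 \<le> N \<Longrightarrow> \<exists>u \<omega>. antiperiodic N u \<and> (\<forall>k. norm (u k) \<le> C) \<and> \<omega>\<^sub>0 \<le> \<omega> \<and> \<omega> \<le> \<omega>\<^sub>1 \<and>
      (\<forall>k. u (k + 1) - 2 *\<^sub>R u k + u (k - 1) = - (\<omega> / (real N)\<^sup>2) *\<^sub>R V' (u k)) \<and>
      (\<Sum>k<N. (norm (real N *\<^sub>R (u (int k + 1) - u (int k))))\<^sup>2 / 2 + \<omega> * V (u (int k)) - \<omega> * h) = 0"
    by (rule discrete_solutions_exist) blast
  define N where "N n = Suc (n + N\<^sub>0)" for n
  have N_pos: "N n > 0" for n by (simp add: N_def)
  have N_lim: "filterlim (\<lambda>n. real (N n)) at_top sequentially"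
    unfolding N_def by real_asymp
  define sol where "sol n u \<omega> \<longleftrightarrow> antiperiodic (N n) u \<and> (\<forall>k. norm (u k) \<le> C) \<and> \<omega>\<^sub>0 \<le> \<omega> \<and> \<omega> \<le> \<omega>\<^sub>1 \<and>
      (\<forall>k. u (k + 1) - 2 *\<^sub>R u k + u (k - 1) = - (\<omega> / (real (N n))\<^sup>2) *\<^sub>R V' (u k)) \<and>
      (\<Sum>k<N n. (norm (real (N n) *\<^sub>R (u (int k + 1) - u (int k))))\<^sup>2 / 2 + \<omega> * V (u (int k)) - \<omega> * h) = 0"
    for n u \<omega>
  have "\<forall>n. \<exists>u \<omega>. sol n u \<omega>"
    unfolding sol_def by (intro allI ex) (simp add: N_def)
  then obtain u where "\<forall>n. \<exists>\<omega>. sol n (u n) \<omega>" by (rule choice[THEN exE])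
  then obtain \<omega> where "\<forall>n. sol n (u n) (\<omega> n)" by (rule choice[THEN exE])
  then have
    ap: "\<And>n. antiperiodic (N n) (u n)" and uC: "\<And>n k. norm (u n k) \<le> C"
    and \<omega>: "\<And>n. \<omega>\<^sub>0 \<le> \<omega> n" "\<And>n. \<omega> n \<le> \<omega>\<^sub>1"
    and eqn: "\<And>n k. u n (k + 1) - 2 *\<^sub>R u n k + u n (k - 1) = - (\<omega> n / (real (N n))\<^sup>2) *\<^sub>R V' (u n k)"
    and energy: "\<And>n. (\<Sum>k<N n. (norm (real (N n) *\<^sub>R (u n (int k + 1) - u n (int k))))\<^sup>2 / 2
        + \<omega> n * V (u n (int k)) - \<omega> n * h) = 0"
    unfolding sol_def by blast+
  define p where "p n k = real (N n) *\<^sub>R (u n (k + 1) - u n k)" for n k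
  have stepu: "u n (k + 1) - u n k = (1 / real (N n)) *\<^sub>R p n k" for n k
    using N_pos[of n] by (simp add: p_def)
  have stepp: "p n (k + 1) - p n k = (1 / real (N n)) *\<^sub>R (- \<omega> n *\<^sub>R V' (u n (k + 1)))" for n k
  proof -
    have "p n (k + 1) - p n k = real (N n) *\<^sub>R (u n (k + 1 + 1) - 2 *\<^sub>R u n (k + 1) + u n (k + 1 - 1))"
      by (simp add: p_def algebra_simps scaleR_2)
    then show ?thesis using N_pos[of n] unfolding eqn by (simp add: power2_eq_square)
  qed
  have \<omega>_abs: "\<bar>\<omega> n\<bar> \<le> \<omega>\<^sub>1" for n using \<omega>[of n] \<omega>\<^sub>0 by simp
  obtain L where lip: "L-lipschitz_on (cball 0 C) V'" using locally_lipschitz by blast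
  have L: "L \<ge> 0" by (rule lipschitz_on_nonneg[OF lip])
  have "bounded (V' ` cball 0 C)"
    by (intro compact_imp_bounded compact_continuous_image continuous_V' compact_cball)
  then obtain B where B: "\<And>q. norm q \<le> C \<Longrightarrow> norm (V' q) \<le> B"
    by (fastforce simp: bounded_iff)
  define K where "K = \<omega>\<^sub>1 * B"
  have lipp: "norm (p n (k + 1) - p n k) \<le> K / real (N n)" for n k
  proof -
    have "\<bar>\<omega> n\<bar> * norm (V' (u n (k + 1))) \<le> K"
      unfolding K_def using \<omega>_abs B[OF uC] by (intro mult_mono) (auto intro: order_trans[OF abs_ge_zero])
    then show ?thesis unfolding stepp by (simp add: divide_right_mono)
  qed
  have "0 \<le> K / real (N 0)" using lipp[of 0 0] norm_ge_zero order_trans by blast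
  then have K: "K \<ge> 0" using N_pos[of 0] by (simp add: zero_le_divide_iff)
  \<comment> \<open>The velocities are antiperiodic as well, so their increments bound their size.\<close>
  have pK: "norm (p n k) \<le> K" for n k
  proof -
    have "antiperiodic (N n) (p n)"
      using ap[of n] antiperiodicD[OF ap[of n], of "_ + 1"]
      unfolding antiperiodic_def p_def by (simp add: algebra_simps)
    then have "2 * norm (p n k) \<le> (\<Sum>j<N n. norm (p n (int j + 1) - p n (int j)))"
      by (rule antiperiodic_norm_le)
    also have "\<dots> \<le> (\<Sum>j<N n. K / real (N n))" by (rule sum_mono) (rule lipp)
    also have "\<dots> = K" using N_pos[of n] by simp
    finally have "2 * norm (p n k) \<le> K" .
    then show ?thesis using norm_ge_zero[of "p n k"] by linarith
  qed
  have lipu: "norm (u n (k + 1) - u n k) \<le> K / real (N n)" for n k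
    unfolding stepu using pK[of n k] by (simp add: divide_right_mono)
  have inv_lim: "(\<lambda>n. c / real (N n)) \<longlonglongrightarrow> 0" for c
    by (rule tendsto_divide_0[OF tendsto_const filterlim_at_top_imp_at_infinity[OF N_lim]])

  define f where "f n t = (u n \<lfloor>real (N n) * t\<rfloor>, p n \<lfloor>real (N n) * t\<rfloor>, \<omega> n)" for n t
  have f_bound: "norm (f n t) \<le> C + (K + \<omega>\<^sub>1)" for n t
    unfolding f_def
    by (intro order_trans[OF norm_Pair_le] add_mono uC pK) (use \<omega>_abs in simp)
  have f_lip: "norm (f n s - f n t) \<le> 2 * K * \<bar>s - t\<bar> + 2 * K / real (N n)" for n s t
  proof -
    let ?i = "\<lfloor>real (N n) * s\<rfloor>" and ?j = "\<lfloor>real (N n) * t\<rfloor>"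
    have "\<bar>real_of_int (?i - ?j)\<bar> \<le> \<bar>real (N n) * s - real (N n) * t\<bar> + 1" by linarith
    also have "\<dots> = real (N n) * \<bar>s - t\<bar> + 1"
      by (simp add: abs_mult flip: right_diff_distrib)
    finally have "K / real (N n) * \<bar>real_of_int (?i - ?j)\<bar> \<le> K / real (N n) * (real (N n) * \<bar>s - t\<bar> + 1)"
      using K by (intro mult_left_mono) auto
    also have "\<dots> = K * \<bar>s - t\<bar> + K / real (N n)" using N_pos[of n] by (simp add: field_simps)
    finally have *: "K / real (N n) * \<bar>real_of_int (?i - ?j)\<bar> \<le> K * \<bar>s - t\<bar> + K / real (N n)" .
    have "norm (f n s - f n t) \<le> norm (u n ?i - u n ?j) + (norm (p n ?i - p n ?j) + norm (\<omega> n - \<omega> n))"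
      unfolding f_def minus_prod_def fst_conv snd_conv
      by (intro order_trans[OF norm_Pair_le] add_mono order_refl norm_Pair_le)
    also have "\<dots> \<le> (K * \<bar>s - t\<bar> + K / real (N n)) + ((K * \<bar>s - t\<bar> + K / real (N n)) + 0)"
      using norm_diff_le_steps[of "u n" "K / real (N n)" ?i ?j, OF lipu]
        norm_diff_le_steps[of "p n" "K / real (N n)" ?i ?j, OF lipp] *
      by (intro add_mono) auto
    finally show ?thesis by simp
  qed
  obtain r g where r: "strict_mono (r :: nat \<Rightarrow> nat)" and g: "\<And>t. (\<lambda>n. f (r n) t) \<longlonglongrightarrow> g t"
    using convergent_subsequence_almost_equicontinuous[OF f_bound f_lip inv_lim] by blast
  have r_lim: "filterlim r at_top sequentially" by (rule filterlim_subseq[OF r])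
  have Nr_lim: "filterlim (\<lambda>n. real (N (r n))) at_top sequentially"
    by (rule filterlim_compose[OF N_lim r_lim])
  have invr_lim: "(\<lambda>n. c / real (N (r n))) \<longlonglongrightarrow> 0" for c
    by (rule filterlim_compose[OF inv_lim r_lim])
  define U where "U t = fst (g t)" for t
  define P where "P t = fst (snd (g t))" for t
  define w where "w = snd (snd (g 0))"
  have U: "(\<lambda>n. u (r n) \<lfloor>real (N (r n)) * t\<rfloor>) \<longlonglongrightarrow> U t" for t
    using tendsto_fst[OF g[of t]] by (simp add: f_def U_def)
  have P: "(\<lambda>n. p (r n) \<lfloor>real (N (r n)) * t\<rfloor>) \<longlonglongrightarrow> P t" for t
    using tendsto_fst[OF tendsto_snd[OF g[of t]]] by (simp add: f_def P_def)
  have w: "(\<lambda>n. \<omega> (r n)) \<longlonglongrightarrow> w"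
    using tendsto_snd[OF tendsto_snd[OF g[of 0]]] by (simp add: f_def w_def)
  have w_pos: "w > 0"
    using LIMSEQ_le_const[OF w, of \<omega>\<^sub>0] \<omega>(1) \<omega>\<^sub>0 by force

  have dU: "(U has_vector_derivative P t) (at t)" for t
    by (rule has_vector_derivative_of_discrete_limit[of _ "\<lambda>n. u (r n)" "\<lambda>n. p (r n)" "2 * K", OF Nr_lim _ U P])
       (rule discrete_taylor; use N_pos stepu lipp in simp)
  have dP: "(P has_vector_derivative - w *\<^sub>R V' (U t)) (at t)" for t
  proof (rule has_vector_derivative_of_discrete_limit[of _ "\<lambda>n. p (r n)"
        "\<lambda>n k. - \<omega> (r n) *\<^sub>R V' (u (r n) (k + 1))" "2 * (\<omega>\<^sub>1 * L * K)", OF Nr_lim _ P])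
    fix n :: nat and i j :: int
    have lip_force: "norm (- \<omega> (r n) *\<^sub>R V' (u (r n) (k + 1 + 1)) - - \<omega> (r n) *\<^sub>R V' (u (r n) (k + 1)))
        \<le> (\<omega>\<^sub>1 * L * K) / real (N (r n))" for k
    proof -
      have "norm (- \<omega> (r n) *\<^sub>R V' (u (r n) (k + 1 + 1)) - - \<omega> (r n) *\<^sub>R V' (u (r n) (k + 1)))
          = \<bar>\<omega> (r n)\<bar> * norm (V' (u (r n) (k + 1 + 1)) - V' (u (r n) (k + 1)))"
        unfolding scaleR_right_diff_distrib[symmetric] by simp
      also have "\<dots> \<le> \<omega>\<^sub>1 * (L * (K / real (N (r n))))"
      proof (rule mult_mono)
        have "norm (V' (u (r n) (k + 1 + 1)) - V' (u (r n) (k + 1)))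
            \<le> L * norm (u (r n) (k + 1 + 1) - u (r n) (k + 1))"
          using lipschitz_onD[OF lip] uC by (simp add: dist_norm)
        also have "\<dots> \<le> L * (K / real (N (r n)))" by (intro mult_left_mono lipu L)
        finally show "norm (V' (u (r n) (k + 1 + 1)) - V' (u (r n) (k + 1))) \<le> L * (K / real (N (r n)))" .
      qed (use \<omega>_abs[of "r n"] in auto)
      finally show ?thesis by simp
    qed
    show "norm (p (r n) j - p (r n) i - (real_of_int (j - i) / real (N (r n))) *\<^sub>R (- \<omega> (r n) *\<^sub>R V' (u (r n) (i + 1))))
        \<le> 2 * (\<omega>\<^sub>1 * L * K) * (real_of_int (j - i) / real (N (r n)))\<^sup>2"
      by (rule discrete_taylor[of "real (N (r n))" "p (r n)"
            "\<lambda>k. - \<omega> (r n) *\<^sub>R V' (u (r n) (k + 1))"]; use N_pos stepp lip_force in simp)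
  next
    fix s
    let ?k = "\<lambda>n. \<lfloor>real (N (r n)) * s\<rfloor>"
    have "(\<lambda>n. u (r n) (?k n + 1) - u (r n) (?k n)) \<longlonglongrightarrow> 0"
      by (rule Lim_null_comparison[OF always_eventually invr_lim[of K]]) (simp add: lipu)
    from tendsto_add[OF this U[of s]] have "(\<lambda>n. u (r n) (?k n + 1)) \<longlonglongrightarrow> U s" by simp
    then show "(\<lambda>n. - \<omega> (r n) *\<^sub>R V' (u (r n) (?k n + 1))) \<longlonglongrightarrow> - w *\<^sub>R V' (U s)"
      by (intro tendsto_intros w continuous_on_tendsto_compose[OF continuous_V'[of UNIV]]) auto
  qed
  have apU: "U (t + 1) = - U t" for t
  proof -
    have "\<lfloor>real (N n) * (t + 1)\<rfloor> = \<lfloor>real (N n) * t\<rfloor> + int (N n)" for n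
      by (simp add: algebra_simps) 
    then have "(\<lambda>n. - u (r n) \<lfloor>real (N (r n)) * t\<rfloor>) \<longlonglongrightarrow> U (t + 1)"
      using U[of "t + 1"] antiperiodicD[OF ap] by simp
    then show ?thesis using tendsto_minus[OF U[of t]] LIMSEQ_unique by blast
  qed

  define E where "E t = (norm (P t))\<^sup>2 / 2 + w * V (U t)" for t
  have "(E has_real_derivative 0) (at t)" for t
  proof -
    have "((\<lambda>t. P t \<bullet> P t) has_derivative (\<lambda>d. P t \<bullet> (d *\<^sub>R (- w *\<^sub>R V' (U t))) + (d *\<^sub>R (- w *\<^sub>R V' (U t))) \<bullet> P t)) (at t)"
      using dP[of t] unfolding has_vector_derivative_def by (intro has_derivative_inner)
    then have "((\<lambda>t. (norm (P t))\<^sup>2) has_real_derivative 2 * (- w * (V' (U t) \<bullet> P t))) (at t)"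
      unfolding has_field_derivative_def power2_norm_eq_inner
      by (rule has_derivative_eq_rhs) (auto simp: inner_commute)
    from DERIV_add[OF DERIV_cdivide[OF this, of 2] DERIV_cmult[OF DERIV_V_along[OF dU], of w]]
    show ?thesis unfolding E_def[abs_def] by (rule DERIV_cong) simp
  qed
  then have E_const: "E t = E 0" for t using DERIV_isconst_all by blast

  define e where "e n k = (norm (p n k))\<^sup>2 / 2 + \<omega> n * V (u n k)" for n k
  define c where "c = \<omega>\<^sub>1 * (L * K\<^sup>2) + K\<^sup>2 / 2"
  have c: "c \<ge> 0" using L K \<omega>_abs[of 0] by (auto simp: c_def intro!: add_nonneg_nonneg mult_nonneg_nonneg)
  have e_step: "norm (e n (k + 1) - e n k) \<le> c / (real (N n))\<^sup>2" for n k
  proof -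
    let ?x = "u n k" and ?y = "u n (k + 1)" and ?d = "p n (k + 1) - p n k"
    \<comment> \<open>The kinetic term changes by the force times the displacement plus a square; the first part
      cancels the linear part of the change of the potential.\<close>
    have "?d \<bullet> p n k = - \<omega> n * (V' ?y \<bullet> (?y - ?x))"
      unfolding stepp stepu by simp
    moreover have "(norm (p n (k + 1)))\<^sup>2 = (norm (p n k))\<^sup>2 + 2 * (?d \<bullet> p n k) + (norm ?d)\<^sup>2"
      unfolding power2_norm_eq_inner by (simp add: algebra_simps inner_commute)
    ultimately have "e n (k + 1) - e n k = \<omega> n * (V ?y - V ?x - V' ?y \<bullet> (?y - ?x)) + (norm ?d)\<^sup>2 / 2"
      by (simp add: e_def algebra_simps add_divide_distrib)
    also have "norm \<dots> \<le> \<bar>\<omega> n\<bar> * \<bar>V ?y - V ?x - V' ?y \<bullet> (?y - ?x)\<bar> + (norm ?d)\<^sup>2 / 2"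
      by (rule order_trans[OF norm_triangle_ineq]) (simp add: abs_mult)
    also have "\<dots> \<le> \<omega>\<^sub>1 * (L * (K / real (N n))\<^sup>2) + (K / real (N n))\<^sup>2 / 2"
    proof (intro add_mono mult_mono divide_right_mono power_mono lipp \<omega>_abs)
      have "\<bar>V ?y - V ?x - V' ?y \<bullet> (?y - ?x)\<bar> \<le> L * (norm (?y - ?x))\<^sup>2"
        by (rule V_taylor[OF lip uC uC])
      also have "\<dots> \<le> L * (K / real (N n))\<^sup>2" by (intro mult_left_mono power_mono lipu L) auto
      finally show "\<bar>V ?y - V ?x - V' ?y \<bullet> (?y - ?x)\<bar> \<le> L * (K / real (N n))\<^sup>2" .
    qed (use \<omega>_abs[of n] in auto)
    also have "\<dots> = c / (real (N n))\<^sup>2" by (simp add: c_def power_divide add_divide_distrib)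
    finally show ?thesis .
  qed
  have e_mean: "norm (e n 0 - \<omega> n * h) \<le> c / real (N n)" for n
  proof -
    have N: "real (N n) > 0" using N_pos by simp
    have near: "norm (e n 0 - e n (int k)) \<le> c / real (N n)" if "k < N n" for k
    proof -
      have "norm (e n 0 - e n (int k)) \<le> c / (real (N n))\<^sup>2 * real k"
        using norm_diff_le_steps[of "e n", OF e_step, of 0 "int k"] by simp
      also have "\<dots> \<le> c / (real (N n))\<^sup>2 * real (N n)" using that c by (intro mult_left_mono) auto
      finally show ?thesis using N by (simp add: power2_eq_square)
    qed
    have "real (N n) * (e n 0 - \<omega> n * h) = (\<Sum>k<N n. e n 0 - e n (int k))"
    proof -
      have "(\<Sum>k<N n. e n (int k) - \<omega> n * h) = 0"
        using energy[of n] by (simp add: e_def p_def)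
      then have "(\<Sum>k<N n. e n 0 - e n (int k)) = (\<Sum>k<N n. e n 0 - e n (int k)) + (\<Sum>k<N n. e n (int k) - \<omega> n * h)"
        by simp
      also have "\<dots> = (\<Sum>k<N n. e n 0 - \<omega> n * h)" unfolding sum.distrib[symmetric] by simp
      finally show ?thesis by simp
    qed
    also have "norm \<dots> \<le> (\<Sum>k<N n. c / real (N n))"
      by (rule sum_norm_le) (use near in auto)
    also have "\<dots> = real (N n) * (c / real (N n))" by simp
    finally have "real (N n) * norm (e n 0 - \<omega> n * h) \<le> real (N n) * (c / real (N n))"
      by (simp only: norm_mult) simp
    then show ?thesis using N mult_le_cancel_left_pos by blast
  qed
  have "(\<lambda>n. e (r n) 0 - \<omega> (r n) * h) \<longlonglongrightarrow> 0"
    by (rule Lim_null_comparison[OF always_eventually invr_lim[of c]]) (use e_mean in simp)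
  moreover have "(\<lambda>n. e (r n) 0 - \<omega> (r n) * h) \<longlonglongrightarrow> E 0 - w * h"
    using U[of 0] P[of 0] w unfolding e_def E_def
    by (intro tendsto_intros continuous_on_tendsto_compose[OF continuous_V[of UNIV]]) auto
  ultimately have "E 0 = w * h" using LIMSEQ_unique by fastforce
  then have "(norm (P t))\<^sup>2 / 2 + w * V (U t) = w * h" for t
    using E_const[of t] by (simp add: E_def)
  then show thesis using that w_pos dU dP apU by blast
qed

text \<open>
Slowing time down by \<open>sqrt w\<close> removes the factor \<open>w\<close> from the equation. The half period \<open>1\<close> becomes
\<open>sqrt w\<close>. A constant antiperiodic solution is zero, and would force \<open>V 0 = h\<close>, whereas \<open>V 0 = G 0 < h\<close>.
\<close>

lemma periodic_solution_exists:
  "\<exists>q v. (\<forall>t. (q has_vector_derivative v t) (at t)) \<and>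
         (\<forall>t. (v has_vector_derivative - V' (q t)) (at t)) \<and>
         (\<forall>t. (norm (v t))\<^sup>2 / 2 + V (q t) = h) \<and>
         (\<exists>T>0. \<forall>t. q (t + T) = q t) \<and>
         \<not> (\<exists>c. \<forall>t. q t = c)"
proof -
  obtain U P :: "real \<Rightarrow> 'a" and w :: real where w: "w > 0"
    and dU: "\<And>t. (U has_vector_derivative P t) (at t)"
    and dP: "\<And>t. (P has_vector_derivative - w *\<^sub>R V' (U t)) (at t)"
    and ap: "\<And>t. U (t + 1) = - U t"
    and energy: "\<And>t. (norm (P t))\<^sup>2 / 2 + w * V (U t) = w * h"
    by (rule rescaled_solution_exists) blast
  define s where "s = sqrt w"
  have s: "s > 0" "s\<^sup>2 = w" using w by (auto simp: s_def)
  have chain: "((\<lambda>t. F (t / s)) has_vector_derivative (1 / s) *\<^sub>R F') (at t)"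
    if "(F has_vector_derivative F') (at (t / s))" for F :: "real \<Rightarrow> 'a" and F' t
  proof -
    have "((\<lambda>t. t / s) has_vector_derivative 1 / s) (at t)"
      using s by (auto intro!: derivative_eq_intros simp: has_real_derivative_iff_has_vector_derivative[symmetric])
    from vector_diff_chain_at[OF this that] show ?thesis by (simp add: o_def)
  qed
  define q where "q t = U (t / s)" for t
  define v where "v t = (1 / s) *\<^sub>R P (t / s)" for t
  have dq: "(q has_vector_derivative v t) (at t)" for t
    unfolding q_def v_def by (rule chain[OF dU])
  have dv: "(v has_vector_derivative - V' (q t)) (at t)" for t
  proof -
    have "((\<lambda>t. (1 / s) *\<^sub>R P (t / s)) has_vector_derivative (1 / s) *\<^sub>R (1 / s) *\<^sub>R (- w *\<^sub>R V' (U (t / s)))) (at t)"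
      by (rule bounded_linear.has_vector_derivative[OF bounded_linear_scaleR_right chain[OF dP]])
    moreover have "(1 / s) *\<^sub>R (1 / s) *\<^sub>R (- w *\<^sub>R V' (U (t / s))) = - V' (q t)"
      using s w by (simp add: q_def power2_eq_square field_simps)
    ultimately show ?thesis unfolding v_def[abs_def] by simp
  qed
  have "(norm (v t))\<^sup>2 / 2 + V (q t) = h" for t
  proof -
    have "w * ((norm (v t))\<^sup>2 / 2 + V (q t)) = w * h"
      using energy[of "t / s"] s w by (simp add: v_def q_def power_divide distrib_left power_mult_distrib)
    then show ?thesis using w by simp
  qed
  moreover have "q (t + 2 * s) = q t" for t
  proof -
    have "(t + 2 * s) / s = t / s + 1 + 1" using s by (simp add: field_simps)
    then show ?thesis using ap[of "t / s"] ap[of "t / s + 1"] by (simp add: q_def add.assoc)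
  qed
  moreover have "\<not> (\<exists>c. \<forall>t. q t = c)"
  proof
    assume "\<exists>c. \<forall>t. q t = c"
    then obtain c where c: "\<And>t. U (t / s) = c" by (auto simp: q_def)
    have Uc: "U t = c" for t using c[of "t * s"] s by simp
    then have "c = - c" using ap[of 0] by simp
    then have "c = 0" by (simp add: eq_neg_iff_add_eq_0 flip: scaleR_2)
    have "U = (\<lambda>_. c)" using Uc by auto
    then have "(U has_vector_derivative 0) (at 0)" by simp
    then have "P 0 = 0" using dU vector_derivative_unique_at by blast
    then have "V 0 = h" using energy[of 0] Uc \<open>c = 0\<close> w by simp
    then show False using G_0_less by (simp add: G_def)
  qed
  moreover have "\<exists>T>0. \<forall>t. q (t + T) = q t" using calculation(2) s by (intro exI[of _ "2 * s"]) auto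
  ultimately show ?thesis using dq dv by blast
qed

end

section \<open>Existence of a periodic solution\<close>

lemma norm_matrix_vector_mult_le:
  fixes A :: "real^'n^'m"
  shows "norm (A *v x) \<le> (\<Sum>i\<in>UNIV. norm (A $ i)) * norm x"
proof -
  have "norm (A *v x) \<le> (\<Sum>i\<in>UNIV. norm ((A *v x) $ i))"
    using norm_le_l1_cart[of "A *v x"] by simp
  also have "\<dots> \<le> (\<Sum>i\<in>UNIV. norm (A $ i) * norm x)"
  proof (rule sum_mono)
    fix i
    have "(A *v x) $ i = A $ i \<bullet> x" by (simp add: matrix_vector_mult_def inner_vec_def)
    then show "norm ((A *v x) $ i) \<le> norm (A $ i) * norm x"
      using Cauchy_Schwarz_ineq2[of "A $ i" x] by simp
  qed
  finally show ?thesis by (simp add: sum_distrib_right)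
qed

text \<open>
The bridge from the definite descriptions to derivatives. Differentiability makes the gradient
exist and be unique, and a continuous Hessian is bounded on balls, which makes the
gradient Lipschitz there by the mean value inequality.
\<close>

lemma C2_function_derivatives:
  assumes "C2_function V"
  shows "GDERIV V q :> gradient V q"
    and "(gradient V has_derivative (\<lambda>x. hessian V q *v x)) (at q)"
    and "\<exists>K. K-lipschitz_on (cball 0 C) (gradient V)"
proof -
  show grad: "GDERIV V q :> gradient V q" for q
  proof -
    obtain D where "(V has_derivative D) (at q)"
      using assms by (auto simp: C2_function_def differentiable_def)
    moreover from this have "D = (\<lambda>x. x \<bullet> adjoint D 1)"
      using adjoint_works[OF has_derivative_linear, of V D "at q"] by (auto simp: inner_commute)
    ultimately have ex: "GDERIV V q :> adjoint D 1" unfolding gderiv_def by metis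
    moreover have "D1 = D2" if "GDERIV V q :> D1" "GDERIV V q :> D2" for D1 D2
    proof -
      have "(\<lambda>x. x \<bullet> D1) = (\<lambda>x. x \<bullet> D2)"
        using has_derivative_unique that unfolding gderiv_def by blast
      then show ?thesis using vector_eq_ldot[of D1 D2] by metis
    qed
    ultimately have "\<exists>!D. GDERIV V q :> D" by blast
    then show ?thesis unfolding gradient_def by (rule theI')
  qed
  show hess: "(gradient V has_derivative (\<lambda>x. hessian V q *v x)) (at q)" for q
  proof -
    have "(gradient V has_derivative frechet_derivative (gradient V) (at q)) (at q)"
      using assms by (simp add: C2_function_def frechet_derivative_works)
    moreover from has_derivative_linear[OF this]
    have "(\<lambda>x. hessian V q *v x) = frechet_derivative (gradient V) (at q)"
      unfolding hessian_def by (auto simp: matrix_works)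
    ultimately show ?thesis by simp
  qed
  let ?k = "\<lambda>q. \<Sum>i\<in>UNIV. norm (hessian V q $ i)"
  have "continuous_on (cball 0 C) ?k"
    using assms continuous_on_subset unfolding C2_function_def
    by (intro continuous_intros) blast
  then have "bounded (?k ` cball 0 C)"
    by (intro compact_imp_bounded compact_continuous_image compact_cball)
  then obtain K where K: "K > 0" "\<And>q. q \<in> cball 0 C \<Longrightarrow> norm (?k q) \<le> K"
    unfolding bounded_pos by blast
  have "norm (gradient V x - gradient V y) \<le> K * norm (x - y)" if "x \<in> cball 0 C" "y \<in> cball 0 C" for x y
  proof (rule differentiable_bound[OF convex_cball _ _ that])
    fix q assume q: "q \<in> cball (0::real^'a) C"
    show "(gradient V has_derivative (\<lambda>x. hessian V q *v x)) (at q within cball 0 C)"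
      using hess has_derivative_at_withinI by blast
    have "norm (hessian V q *v x) \<le> K * norm x" for x
    proof -
      have "?k q \<le> K" using K(2)[OF q] by simp
      then show ?thesis
        using norm_matrix_vector_mult_le[of "hessian V q" x] mult_right_mono[of "?k q" K "norm x"] by simp
    qed
    then show "onorm (\<lambda>x. hessian V q *v x) \<le> K" by (rule onorm_le)
  qed
  then have "K-lipschitz_on (cball 0 C) (gradient V)"
    using K by (auto intro!: lipschitz_onI simp: dist_norm)
  then show "\<exists>K. K-lipschitz_on (cball 0 C) (gradient V)" by blast
qed

theorem theorem1p6:
  fixes V :: "real^'n \<Rightarrow> real" and h \<mu>\<^sub>1 \<mu>\<^sub>2 :: real
  assumes "C2_function V"
    and "\<forall>q. V (- q) = V q"
    and "\<mu>\<^sub>1 > 0" and "\<mu>\<^sub>2 \<ge> 0"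
    and "\<forall>q. gradient V q \<bullet> q \<ge> \<mu>\<^sub>1 * V q - \<mu>\<^sub>2"
    and "\<exists>R. \<forall>q. norm q \<ge> R \<longrightarrow> V q \<ge> h"
    and "\<forall>q. q \<noteq> 0 \<longrightarrow> 3 * (gradient V q \<bullet> q) + (hessian V q *v q) \<bullet> q \<noteq> 0"
    and "h > \<mu>\<^sub>2 / \<mu>\<^sub>1"
  shows "\<exists>q :: real \<Rightarrow> real^'n.
           solves_fixed_energy_system V h q \<and>
           (\<exists>T>0. \<forall>t. q (t + T) = q t) \<and>
           \<not> (\<exists>c. \<forall>t. q t = c)"
proof -
  obtain R where R: "\<And>q. norm q \<ge> R \<Longrightarrow> V q \<ge> h" using assms(6) by blast
  interpret even_potential_well V "gradient V" "\<lambda>q x. hessian V q *v x" h \<mu>\<^sub>1 \<mu>\<^sub>2 R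
  proof
    show "\<mu>\<^sub>2 < \<mu>\<^sub>1 * h" using assms(3,8) by (simp add: field_simps)
  qed (use assms R C2_function_derivatives[OF assms(1)] in auto)
  obtain q v where qv: "\<And>t. (q has_vector_derivative v t) (at t)"
      "\<And>t. (v has_vector_derivative - gradient V (q t)) (at t)"
      "\<And>t. (norm (v t))\<^sup>2 / 2 + V (q t) = h"
    and per: "\<exists>T>0. \<forall>t. q (t + T) = q t" "\<not> (\<exists>c. \<forall>t. q t = c)"
    using periodic_solution_exists by blast
  have "solves_fixed_energy_system V h q"
    unfolding solves_fixed_energy_system_def using qv by (intro exI[of _ v] exI[of _ "\<lambda>t. - gradient V (q t)"]) auto
  with per show ?thesis by blast
qed

end
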